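(* Let $\mathscr{P}$ be a closed hereditary topological property preserved under countable closed sums, and let $X$ be a normal locally-$\mathscr{P}$ space. Suppose moreover that for each subspace of $X$ having $\mathscr{P}$, its closure in $X$ has a $\mathscr{P}$-neighborhood in $X$. Then $C_{\mathscr{P}}(X)$ is a Banach subalgebra of $C_b(X)$ isometrically isomorphic to $C_c(Y)$ for some locally compact space $Y$, unique up to homeomorphism, namely $Y=\lambda_{\mathscr{P}}X$. Moreover: - $C_{\mathscr{P}}(X)=\{f\in C_b(X):\mathrm{supp}(f)\text{ has }\mathscr{P}\}$. - $C_c(Y)=C_0(Y)$. - $Y$ is countably compact. - If $X$ does not have $\mathscr{P}$, then $Y$ is neither Lindelöf nor paracompact.
   Context: The scalar field is fixed and is either $\mathbb{R}$ or $\mathbb{C}$. Spaces are topological spaces, assumed non-empty. Normal and completely regular spaces are Hausdorff; compact, locally compact and paracompact spaces are Hausdorff; Lindelöf spaces are regular (Hausdorff). A topological property is a property of spaces invariant under homeomorphism. $\mathscr{P}$ is closed hereditary if every closed subspace of a space with $\mathscr{P}$ has $\mathscr{P}$. $\mathscr{P}$ is preserved under countable closed sums if any space that is a countable union of closed subspaces each having $\mathscr{P}$ has $\mathscr{P}$. A $\mathscr{P}$-neighborhood of a point (or set) is a neighborhood of it (i.e. a set whose interior contains it) that, as a subspace, has $\mathscr{P}$. $X$ is locally-$\mathscr{P}$ if each of its points has a $\mathscr{P}$-neighborhood in $X$. $C_b(X)$ is the algebra of continuous bounded scalar-valued functions on $X$ with the supremum norm. For $f\in C_b(X)$, $\mathrm{Coz}(f)=\{x\in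 X: f(x)\neq 0\}$, $\mathrm{supp}(f)=\mathrm{cl}_X\mathrm{Coz}(f)$, and $\mathrm{Coz}(X)=\{\mathrm{Coz}(f):f\in C_b(X)\}$. $C_c(Y)$ is the set of $f\in C_b(Y)$ with compact support, and $C_0(Y)$ is the set of $f\in C_b(Y)$ such that $|f|^{-1}([\epsilon,\infty))$ is compact for each $\epsilon>0$. Define $$C_{\mathscr{P}}(X)=\{f\in C_b(X):\mathrm{supp}(f)\text{ has a }\mathscr{P}\text{-neighborhood in }X\}.$$ For a completely regular space $X$ with Stone–Čech compactification $\beta X$, define the subspace $$\lambda_{\mathscr{P}}X=\bigcup\{\mathrm{int}_{\beta X}\mathrm{cl}_{\beta X}C: C\in\mathrm{Coz}(X)\text{ and }\mathrm{cl}_XC\text{ has }\mathscr{P}\}$$ of $\beta X$. *)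

theory Defs
  imports "HOL-Analysis.Analysis"
begin

text \<open>
  The scalar field is a type of sort \<open>{real_normed_field, heine_borel}\<close>. Both \<open>real\<close> and
  \<open>complex\<close> are instances. Up to isometric isomorphism there are no others, because the norm of a
  \<open>real_normed_field\<close> is multiplicative (Gelfand--Mazur), so a type variable of this sort
  expresses ``the reals or the complex numbers''.
\<close>

section \<open>Topological properties\<close>

text \<open>
  A property of spaces is a predicate on the topologies over the type of points of the given
  space. Only subspaces of that space are ever tested for the property, and a property of all spaces
  restricts to such a predicate. The empty space is admitted here as a closed subspace, so a closed
  hereditary property that holds of some space holds of the empty one.
\<close>

definition topological_property :: "('a topology \<Rightarrow> bool) \<Rightarrow> bool" where
  "topological_property P \<longleftrightarrow> (\<forall>X Y. X homeomorphic_space Y \<longrightarrow> P X \<longrightarrow> P Y)"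

definition closed_hereditary :: "('a topology \<Rightarrow> bool) \<Rightarrow> bool" where
  "closed_hereditary P \<longleftrightarrow> (\<forall>X S. P X \<and> closedin X S \<longrightarrow> P (subtopology X S))"

definition preserved_under_countable_closed_sums :: "('a topology \<Rightarrow> bool) \<Rightarrow> bool" where
  "preserved_under_countable_closed_sums P \<longleftrightarrow>
     (\<forall>X \<C>. countable \<C> \<and> (\<forall>C\<in>\<C>. closedin X C \<and> P (subtopology X C)) \<and> \<Union>\<C> = topspace X
        \<longrightarrow> P X)"

definition P_neighbourhood :: "('a topology \<Rightarrow> bool) \<Rightarrow> 'a topology \<Rightarrow> 'a set \<Rightarrow> 'a set \<Rightarrow> bool" where
  "P_neighbourhood P X S N \<longleftrightarrow>
     N \<subseteq> topspace X \<and> S \<subseteq> X interior_of N \<and> P (subtopology X N)"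

definition locally_P_space :: "('a topology \<Rightarrow> bool) \<Rightarrow> 'a topology \<Rightarrow> bool" where
  "locally_P_space P X \<longleftrightarrow> (\<forall>x\<in>topspace X. \<exists>N. P_neighbourhood P X {x} N)"

text \<open>As for \<^const>\<open>compact_space\<close> and \<^const>\<open>Lindelof_space\<close>, these two are the bare covering
  conditions; separation axioms are stated separately.\<close>

definition countably_compact_space :: "'a topology \<Rightarrow> bool" where
  "countably_compact_space X \<longleftrightarrow>
     (\<forall>\<U>. countable \<U> \<and> (\<forall>U\<in>\<U>. openin X U) \<and> \<Union>\<U> = topspace X
        \<longrightarrow> (\<exists>\<V>. finite \<V> \<and> \<V> \<subseteq> \<U> \<and> \<Union>\<V> = topspace X))"

definition paracompact_space :: "'a topology \<Rightarrow> bool" where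
  "paracompact_space X \<longleftrightarrow>
     (\<forall>\<U>. (\<forall>U\<in>\<U>. openin X U) \<and> \<Union>\<U> = topspace X
        \<longrightarrow> (\<exists>\<V>. (\<forall>V\<in>\<V>. openin X V \<and> (\<exists>U\<in>\<U>. V \<subseteq> U)) \<and> \<Union>\<V> = topspace X \<and>
                 locally_finite_in X \<V>))"

section \<open>Function algebras\<close>

text \<open>
  \<^const>\<open>cfunspace\<close> is the space of bounded continuous maps with the supremum metric. Its elements
  are extensional on \<open>topspace X\<close>, hence the restrictions in the algebra operations below.
\<close>

definition Cb :: "'a topology \<Rightarrow> ('a \<Rightarrow> 'k::real_normed_field) set" where
  "Cb X = mspace (cfunspace X euclidean_metric)"

definition sup_norm :: "'a topology \<Rightarrow> ('a \<Rightarrow> 'k::real_normed_field) \<Rightarrow> real" where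
  "sup_norm X f = mdist (cfunspace X euclidean_metric) f (\<lambda>x\<in>topspace X. 0)"

definition Coz :: "'a topology \<Rightarrow> ('a \<Rightarrow> 'k::real_normed_field) \<Rightarrow> 'a set" where
  "Coz X f = {x \<in> topspace X. f x \<noteq> 0}"

definition supp :: "'a topology \<Rightarrow> ('a \<Rightarrow> 'k::real_normed_field) \<Rightarrow> 'a set" where
  "supp X f = X closure_of Coz X f"

definition cozero_sets :: "'k::real_normed_field itself \<Rightarrow> 'a topology \<Rightarrow> 'a set set" where
  "cozero_sets _ X = Coz X ` (Cb X :: ('a \<Rightarrow> 'k) set)"

definition Cc :: "'a topology \<Rightarrow> ('a \<Rightarrow> 'k::real_normed_field) set" where
  "Cc X = {f \<in> Cb X. compactin X (supp X f)}"

definition C0 :: "'a topology \<Rightarrow> ('a \<Rightarrow> 'k::real_normed_field) set" where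
  "C0 X = {f \<in> Cb X. \<forall>\<epsilon>>0. compactin X {x \<in> topspace X. \<epsilon> \<le> norm (f x)}}"

definition CP :: "('a topology \<Rightarrow> bool) \<Rightarrow> 'a topology \<Rightarrow> ('a \<Rightarrow> 'k::real_normed_field) set" where
  "CP P X = {f \<in> Cb X. \<exists>N. P_neighbourhood P X (supp X f) N}"

definition banach_subalgebra :: "'a topology \<Rightarrow> ('a \<Rightarrow> 'k::real_normed_field) set \<Rightarrow> bool" where
  "banach_subalgebra X A \<longleftrightarrow>
     A \<subseteq> Cb X \<and>
     (\<lambda>x\<in>topspace X. 0) \<in> A \<and>
     (\<forall>f\<in>A. \<forall>g\<in>A. (\<lambda>x\<in>topspace X. f x + g x) \<in> A) \<and>
     (\<forall>c. \<forall>f\<in>A. (\<lambda>x\<in>topspace X. c * f x) \<in> A) \<and>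
     (\<forall>f\<in>A. \<forall>g\<in>A. (\<lambda>x\<in>topspace X. f x * g x) \<in> A) \<and>
     mcomplete_of (submetric (cfunspace X euclidean_metric) A)"

definition isometric_isomorphism ::
  "'a topology \<Rightarrow> ('a \<Rightarrow> 'k::real_normed_field) set \<Rightarrow> 'b topology \<Rightarrow> ('b \<Rightarrow> 'k) set
     \<Rightarrow> (('a \<Rightarrow> 'k) \<Rightarrow> ('b \<Rightarrow> 'k)) \<Rightarrow> bool" where
  "isometric_isomorphism X A Y B T \<longleftrightarrow>
     bij_betw T A B \<and>
     (\<forall>f\<in>A. \<forall>g\<in>A. T (\<lambda>x\<in>topspace X. f x + g x) = (\<lambda>y\<in>topspace Y. T f y + T g y)) \<and>
     (\<forall>c. \<forall>f\<in>A. T (\<lambda>x\<in>topspace X. c * f x) = (\<lambda>y\<in>topspace Y. c * T f y)) \<and>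
     (\<forall>f\<in>A. \<forall>g\<in>A. T (\<lambda>x\<in>topspace X. f x * g x) = (\<lambda>y\<in>topspace Y. T f y * T g y)) \<and>
     (\<forall>f\<in>A. sup_norm Y (T f) = sup_norm X f)"

definition isometrically_isomorphic ::
  "'a topology \<Rightarrow> ('a \<Rightarrow> 'k::real_normed_field) set \<Rightarrow> 'b topology \<Rightarrow> ('b \<Rightarrow> 'k) set \<Rightarrow> bool" where
  "isometrically_isomorphic X A Y B \<longleftrightarrow> (\<exists>T. isometric_isomorphism X A Y B T)"

section \<open>The Stone--Cech compactification\<close>

text \<open>
  The closure of the image of the space under the Tychonoff embedding into the cube indexed by its
  continuous maps into the unit interval.
\<close>

definition unit_maps :: "'a topology \<Rightarrow> ('a \<Rightarrow> real) set" where
  "unit_maps X = mspace (submetric (cfunspace X euclidean_metric) {f. f \<in> topspace X \<rightarrow> {0..1}})"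

definition beta_embed :: "'a topology \<Rightarrow> 'a \<Rightarrow> (('a \<Rightarrow> real) \<Rightarrow> real)" where
  "beta_embed X x = (\<lambda>f\<in>unit_maps X. f x)"

definition stone_cech :: "'a topology \<Rightarrow> (('a \<Rightarrow> real) \<Rightarrow> real) topology" where
  "stone_cech X =
     (let cube = product_topology (\<lambda>f. top_of_set {0..1}) (unit_maps X)
      in subtopology cube (cube closure_of (beta_embed X ` topspace X)))"

lemma compact_space_stone_cech: "compact_space (stone_cech X)"
proof -
  have "compact_space (product_topology (\<lambda>f. top_of_set {0..1::real}) (unit_maps X))"
    by (simp add: compact_space_product_topology compact_space_subtopology)
  then show ?thesis
    unfolding stone_cech_def Let_def
    by (rule compact_space_subtopology[OF closedin_compact_space[OF _ closedin_closure_of]])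
qed

lemma Hausdorff_space_stone_cech: "Hausdorff_space (stone_cech X)"
  unfolding stone_cech_def Let_def
  by (rule Hausdorff_space_subtopology)
     (simp add: Hausdorff_space_product_topology Hausdorff_space_subtopology)

lemma beta_embed_in_cube:
  "beta_embed X ` topspace X \<subseteq> topspace (product_topology (\<lambda>f. top_of_set {0..1}) (unit_maps X))"
proof -
  have "f x \<in> {0..1}" if "f \<in> unit_maps X" "x \<in> topspace X" for f x
    using that unfolding unit_maps_def mspace_submetric Pi_iff by blast
  then show ?thesis
    by (auto simp: beta_embed_def simp del: atLeastAtMost_iff)
qed

lemma stone_cech_dense:
  "stone_cech X closure_of (beta_embed X ` topspace X) = topspace (stone_cech X)"
proof -
  let ?C = "product_topology (\<lambda>f. top_of_set {0..1::real}) (unit_maps X)"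
  have "beta_embed X ` topspace X \<subseteq> ?C closure_of (beta_embed X ` topspace X)"
    by (rule closure_of_subset[OF beta_embed_in_cube])
  then show ?thesis
    unfolding stone_cech_def Let_def closure_of_subtopology topspace_subtopology
    using closure_of_subset_topspace[of ?C "beta_embed X ` topspace X"] by (simp add: Int_absorb1)
qed

lemma embedding_map_beta_embed:
  assumes "completely_regular_space X" "Hausdorff_space X"
  shows "embedding_map X (stone_cech X) (beta_embed X)"
proof -
  have "embedding_map X (product_topology (\<lambda>f. top_of_set {0..1}) (unit_maps X)) (beta_embed X)"
    using completely_regular_space_cube_embedding_explicit[OF assms]
    unfolding unit_maps_def beta_embed_def .
  then show ?thesis
    using closure_of_subset[OF beta_embed_in_cube[of X]]
    unfolding stone_cech_def Let_def embedding_map_in_subtopology by blast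
qed

lemma stone_cech_extension:
  assumes "continuous_map X (top_of_set {0..1::real}) f"
  shows "\<exists>F. continuous_map (stone_cech X) (top_of_set {0..1}) F \<and>
             (\<forall>x\<in>topspace X. F (beta_embed X x) = f x)"
proof -
  let ?f = "restrict f (topspace X)"
  have "?f \<in> unit_maps X"
    using assms bounded_subset[OF bounded_closed_interval, of "f ` topspace X" 0 1]
    by (auto simp: unit_maps_def continuous_map_in_subtopology)
  then have "continuous_map (stone_cech X) (top_of_set {0..1}) (\<lambda>p. p ?f) \<and>
             (\<forall>x\<in>topspace X. beta_embed X x ?f = f x)"
    by (auto simp: stone_cech_def Let_def beta_embed_def
             intro!: continuous_map_from_subtopology continuous_map_product_projection)
  then show ?thesis by blast
qed

text \<open>The scalar type is passed on because \<^const>\<open>cozero_sets\<close> refers to scalar-valued functions.\<close>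

definition lambda_P ::
  "'k::real_normed_field itself \<Rightarrow> ('a topology \<Rightarrow> bool) \<Rightarrow> 'a topology
     \<Rightarrow> (('a \<Rightarrow> real) \<Rightarrow> real) topology" where
  "lambda_P K P X =
     subtopology (stone_cech X)
       (\<Union>{stone_cech X interior_of (stone_cech X closure_of (beta_embed X ` C)) | C.
            C \<in> cozero_sets K X \<and> P (subtopology X (X closure_of C))})"

end

theory Submission
  imports Defs
begin

text \<open>
  The closed subspaces of \<open>X\<close> having \<open>P\<close> form an ideal in which every countable family has an upper
  bound, the closure of its union. Hence the functions whose support has \<open>P\<close> are closed under the
  algebra operations and under uniform limits. By normality, \<open>lambda_P\<close> is the union of the closures
  in the Stone--Cech compactification of these subspaces, so every countable union of compact subsets
  of \<open>lambda_P\<close> lies in a single such closure, which is compact. This gives countable compactness and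
  \<open>Cc = C0\<close>; and if countably many of these closures covered \<open>lambda_P\<close>, then \<open>X\<close> itself would have
  \<open>P\<close>, which excludes the Lindelof property and, since a locally finite family in a countably compact
  space is finite, paracompactness. The isomorphism is restriction to \<open>X\<close>, with inverse the
  Stone--Cech extension. For uniqueness, every nonzero multiplicative functional on \<open>Cc Z\<close> is the
  evaluation at a point of \<open>Z\<close>, so an algebra isomorphism is composition with a homeomorphism.
\<close>


section \<open>Bounded continuous functions and functions with compact support\<close>

lemma mem_Cb:
  fixes f :: "'a \<Rightarrow> 'k::real_normed_field"
  shows "f \<in> Cb X \<longleftrightarrow>
    continuous_map X euclidean f \<and> bounded (f ` topspace X) \<and> f \<in> extensional (topspace X)"
  by (auto simp: Cb_def)

lemma Cb_restrictI:
  fixes f :: "'a \<Rightarrow> 'k::real_normed_field"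
  assumes "continuous_map X euclidean f" "\<And>x. x \<in> topspace X \<Longrightarrow> norm (f x) \<le> B"
  shows "restrict f (topspace X) \<in> Cb X"
proof -
  have "continuous_map X euclidean (restrict f (topspace X))"
    by (rule continuous_map_eq[OF assms(1)]) simp
  moreover have "bounded (restrict f (topspace X) ` topspace X)"
    using assms(2) by (auto simp: bounded_iff)
  ultimately show ?thesis by (simp add: mem_Cb)
qed

lemma Cb_bound:
  assumes "f \<in> Cb X"
  obtains B where "0 < B" "\<And>x. x \<in> topspace X \<Longrightarrow> norm (f x) \<le> B"
  using assms by (auto simp: mem_Cb bounded_pos)

lemma continuous_map_mult_field:
  fixes f g :: "'a \<Rightarrow> 'k::real_normed_field"
  assumes "continuous_map X euclidean f" "continuous_map X euclidean g"
  shows "continuous_map X euclidean (\<lambda>x. f x * g x)"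
  using assms by (simp add: continuous_map_atin tendsto_mult)

lemma Cb_zero: "(\<lambda>x\<in>topspace X. 0) \<in> Cb X"
  by (rule Cb_restrictI[where B=0]) auto

lemma Cb_add:
  assumes "f \<in> Cb X" "g \<in> Cb X"
  shows "(\<lambda>x\<in>topspace X. f x + g x) \<in> Cb X"
proof -
  obtain A B where "\<And>x. x \<in> topspace X \<Longrightarrow> norm (f x) \<le> A" "\<And>x. x \<in> topspace X \<Longrightarrow> norm (g x) \<le> B"
    using assms Cb_bound by metis
  then show ?thesis
    using assms by (intro Cb_restrictI[where B="A+B"] continuous_map_add norm_triangle_mono)
      (simp_all add: mem_Cb)
qed

lemma Cb_mult:
  assumes "f \<in> Cb X" "g \<in> Cb X"
  shows "(\<lambda>x\<in>topspace X. f x * g x) \<in> Cb X"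
proof -
  obtain A B where "\<And>x. x \<in> topspace X \<Longrightarrow> norm (f x) \<le> A" "0 < A"
    "\<And>x. x \<in> topspace X \<Longrightarrow> norm (g x) \<le> B"
    using assms Cb_bound by metis
  then show ?thesis
    using assms by (intro Cb_restrictI[where B="A*B"] continuous_map_mult_field)
      (simp_all add: mem_Cb norm_mult mult_mono)
qed

lemma Cb_const: "(\<lambda>x\<in>topspace X. c) \<in> Cb X"
  by (rule Cb_restrictI[where B="norm c"]) auto

lemma Cb_scale:
  assumes "f \<in> Cb X"
  shows "(\<lambda>x\<in>topspace X. c * f x) \<in> Cb X"
proof -
  have "(\<lambda>x\<in>topspace X. (\<lambda>x\<in>topspace X. c) x * f x) \<in> Cb X"
    by (intro Cb_mult Cb_const assms)
  also have "(\<lambda>x\<in>topspace X. (\<lambda>x\<in>topspace X. c) x * f x) = (\<lambda>x\<in>topspace X. c * f x)"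
    by auto
  finally show ?thesis .
qed

text \<open>Later comparisons of norms go through upper bounds only. On an empty space every
  \<open>a\<close> satisfies the right side, hence the second hypothesis.\<close>

lemma sup_norm_le_iff:
  fixes f :: "'a \<Rightarrow> 'b::real_normed_field"
  assumes "f \<in> Cb X" "topspace X \<noteq> {}"
  shows "sup_norm X f \<le> a \<longleftrightarrow> (\<forall>x\<in>topspace X. norm (f x) \<le> a)"
proof -
  have "f \<in> mspace (funspace (topspace X) euclidean_metric)"
    by (rule subsetD[OF cfunspace_subset_funspace assms(1)[unfolded Cb_def]])
  moreover have "(\<lambda>x\<in>topspace X. 0 :: 'b) \<in> mspace (funspace (topspace X) euclidean_metric)"
    by (rule subsetD[OF cfunspace_subset_funspace Cb_zero[unfolded Cb_def]])
  ultimately show ?thesis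
    using assms(2)
    by (simp add: sup_norm_def mdist_cfunspace_eq_mdist_funspace funspace_mdist_le del: mdist_funspace)
qed

lemma openin_Coz: "f \<in> Cb X \<Longrightarrow> openin X (Coz X f)"
  unfolding Coz_def mem_Cb
  using openin_continuous_map_preimage[of X euclidean f "- {0}"] by (auto simp: open_Compl)

lemma Coz_subset_supp: "Coz X f \<subseteq> supp X f"
  unfolding supp_def by (rule closure_of_subset) (auto simp: Coz_def)

lemma closedin_supp: "closedin X (supp X f)"
  by (simp add: supp_def)

lemma supp_minimal: "\<lbrakk>closedin X D; Coz X f \<subseteq> D\<rbrakk> \<Longrightarrow> supp X f \<subseteq> D"
  unfolding supp_def by (rule closure_of_minimal)

text \<open>The support is the least closed set containing the cozero set, so it is a closed subset
  of the compact set \<open>K\<close>.\<close>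

lemma Cc_I:
  assumes "f \<in> Cb X" "compactin X K" "closedin X K" "Coz X f \<subseteq> K"
  shows "f \<in> Cc X"
  using assms(1) closed_compactin[OF assms(2) supp_minimal[OF assms(3,4)] closedin_supp]
  by (simp add: Cc_def)

lemma Cc_subset_Cb: "Cc X \<subseteq> Cb X"
  by (auto simp: Cc_def)

lemma Cc_I2:
  assumes "f \<in> Cc X" "g \<in> Cb X" "Coz X g \<subseteq> supp X f"
  shows "g \<in> Cc X"
proof (rule Cc_I)
  show "compactin X (supp X f)" using assms(1) by (simp add: Cc_def)
qed (use assms closedin_supp in auto)

lemma Cc_scale:
  assumes "f \<in> Cc X"
  shows "(\<lambda>x\<in>topspace X. c * f x) \<in> Cc X"
proof (rule Cc_I2[OF assms])
  show "(\<lambda>x\<in>topspace X. c * f x) \<in> Cb X"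
    using assms by (simp add: Cb_scale Cc_def)
  show "Coz X (\<lambda>x\<in>topspace X. c * f x) \<subseteq> supp X f"
    using Coz_subset_supp[of X f] by (auto simp: Coz_def)
qed

lemma Cc_mult:
  assumes "f \<in> Cc X" "g \<in> Cb X"
  shows "(\<lambda>x\<in>topspace X. f x * g x) \<in> Cc X"
proof (rule Cc_I2[OF assms(1)])
  show "(\<lambda>x\<in>topspace X. f x * g x) \<in> Cb X"
    using assms by (simp add: Cb_mult Cc_def)
  show "Coz X (\<lambda>x\<in>topspace X. f x * g x) \<subseteq> supp X f"
    using Coz_subset_supp[of X f] by (auto simp: Coz_def)
qed

lemma Coz_add: "Coz X (\<lambda>x\<in>topspace X. f x + g x) \<subseteq> Coz X f \<union> Coz X g"
  by (auto simp: Coz_def)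

lemma Cc_add:
  assumes "f \<in> Cc X" "g \<in> Cc X"
  shows "(\<lambda>x\<in>topspace X. f x + g x) \<in> Cc X"
proof (rule Cc_I)
  show "(\<lambda>x\<in>topspace X. f x + g x) \<in> Cb X"
    using assms by (simp add: Cb_add Cc_def)
  show "compactin X (supp X f \<union> supp X g)"
    using assms by (simp add: compactin_Un Cc_def)
  show "closedin X (supp X f \<union> supp X g)"
    by (simp add: closedin_supp closedin_Un)
  show "Coz X (\<lambda>x\<in>topspace X. f x + g x) \<subseteq> supp X f \<union> supp X g"
    using Coz_add[of X f g] Coz_subset_supp[of X f] Coz_subset_supp[of X g] by blast
qed

lemma Cc_subset_C0: "Cc X \<subseteq> (C0 X :: ('a \<Rightarrow> 'b::real_normed_field) set)"
proof
  fix f :: "'a \<Rightarrow> 'b" assume f: "f \<in> Cc X"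
  have "compactin X {x \<in> topspace X. \<epsilon> \<le> norm (f x)}" if "\<epsilon> > 0" for \<epsilon>
  proof (rule closed_compactin[of X "supp X f"])
    show "compactin X (supp X f)" using f by (simp add: Cc_def)
    show "{x \<in> topspace X. \<epsilon> \<le> norm (f x)} \<subseteq> supp X f"
      using that Coz_subset_supp[of X f] by (auto simp: Coz_def)
    have "continuous_map X euclidean (\<lambda>x. norm (f x))"
      using f by (auto simp: Cc_def mem_Cb intro: continuous_map_norm)
    from closedin_continuous_map_preimage[OF this, of "{\<epsilon>..}"]
    show "closedin X {x \<in> topspace X. \<epsilon> \<le> norm (f x)}" by simp
  qed
  with f show "f \<in> C0 X" by (auto simp: Cc_def C0_def)
qed

lemma continuous_map_eq_on_dense:
  fixes f g :: "'a \<Rightarrow> 'k::real_normed_field"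
  assumes "X closure_of S = topspace X"
    and "continuous_map X euclidean f" "continuous_map X euclidean g" "\<And>x. x \<in> S \<Longrightarrow> f x = g x"
    and "x \<in> topspace X"
  shows "f x = g x"
  using forall_in_closure_of_eq[of x X S euclidean f g] assms by (auto simp: Hausdorff_space_euclidean)

text \<open>A Urysohn function at \<open>z\<close> gets compact support once its cozero set is
  confined to a compact neighbourhood of \<open>z\<close>. These functions separate points and
  recover the topology of \<open>Z\<close>.\<close>

lemma Cc_separation:
  assumes "locally_compact_space Z" "Hausdorff_space Z" "openin Z U" "z \<in> U"
  obtains f where "f \<in> (Cc Z :: ('a \<Rightarrow> 'k::real_normed_field) set)" "f z = 1" "Coz Z f \<subseteq> U"
proof -
  have zZ: "z \<in> topspace Z" using assms openin_subset by blast
  obtain V K where VK: "openin Z V" "compactin Z K" "z \<in> V" "V \<subseteq> K"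
    using assms(1) zZ unfolding locally_compact_space_def by blast
  have "completely_regular_space Z"
    using assms by (simp add: locally_compact_Hausdorff_imp_regular_space
        locally_compact_regular_imp_completely_regular_space)
  moreover have "openin Z (U \<inter> V)" "z \<in> U \<inter> V" using assms VK by auto
  ultimately obtain g :: "'a \<Rightarrow> real" where g: "continuous_map Z (top_of_set {0..1}) g" "g z = 0"
    "g ` (topspace Z - U \<inter> V) \<subseteq> {1}"
    unfolding completely_regular_space_def
    by (metis Diff_Diff_Int Diff_iff closedin_def closedin_topspace inf.absorb_iff2 openin_closedin_eq)
  \<comment> \<open>Complete regularity gave the value 0 at \<open>z\<close> and 1 off the
    neighbourhood; \<open>1 - g\<close> exchanges the two.\<close>
  define f where "f = (\<lambda>x\<in>topspace Z. of_real (1 - g x) :: 'k)"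
  have g': "continuous_map Z euclidean g" "\<And>x. x \<in> topspace Z \<Longrightarrow> 0 \<le> g x \<and> g x \<le> 1"
    using g(1) by (auto simp: continuous_map_in_subtopology Pi_iff)
  have "f \<in> Cb Z"
    unfolding f_def
  proof (rule Cb_restrictI[where B=1])
    show "continuous_map Z euclidean (\<lambda>x. of_real (1 - g x) :: 'k)"
      using g'(1) by (simp add: continuous_map_atin tendsto_intros)
    show "norm (of_real (1 - g x) :: 'k) \<le> 1" if "x \<in> topspace Z" for x
      using g'(2)[OF that] by (simp del: of_real_diff)
  qed
  moreover have C: "Coz Z f \<subseteq> U \<inter> V"
    using g(3) by (fastforce simp: Coz_def f_def)
  ultimately have "f \<in> Cc Z"
    using VK assms by (intro Cc_I[where K=K]) (auto simp: compactin_imp_closedin)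
  moreover have "f z = 1" using zZ g(2) by (simp add: f_def)
  ultimately show ?thesis using that C by blast
qed


subsection \<open>Isomorphic algebras of compactly supported functions\<close>

text \<open>Over the complex numbers this is conjugation, over the reals the identity. At 0 the
  division yields 0, and continuity there holds because the quotient always has the norm of
  \<open>w\<close>.\<close>

lemma continuous_on_norm_square_divide:
  "continuous_on UNIV (\<lambda>w::'k::real_normed_field. of_real ((norm w)\<^sup>2) / w)"
proof -
  have "isCont (\<lambda>w::'k. of_real ((norm w)\<^sup>2) / w) w" for w
  proof (cases "w = 0")
    case True
    have "norm (of_real ((norm v)\<^sup>2) / v) = norm v" for v :: 'k
      by (simp add: norm_divide norm_mult power2_eq_square)
    then have "((\<lambda>v::'k. of_real ((norm v)\<^sup>2) / v) \<longlongrightarrow> 0) (at 0)"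
      by (subst tendsto_norm_zero_iff[symmetric]) (simp add: tendsto_norm_zero)
    then show ?thesis using True by (simp add: isCont_def)
  next
    case False
    then show ?thesis by (intro continuous_intros) auto
  qed
  then show ?thesis by (simp add: continuous_at_imp_continuous_on)
qed

text \<open>Stands in for the complex conjugate: \<open>f * Cb_conj Z f\<close> is the square of the norm of \<open>f\<close>.\<close>

definition Cb_conj :: "'a topology \<Rightarrow> ('a \<Rightarrow> 'k::real_normed_field) \<Rightarrow> 'a \<Rightarrow> 'k" where
  "Cb_conj Z f = (\<lambda>z\<in>topspace Z. of_real ((norm (f z))\<^sup>2) / f z)"

lemma Cb_conj_in_Cb:
  fixes f :: "'a \<Rightarrow> 'k::real_normed_field"
  assumes "f \<in> Cb Z"
  shows "Cb_conj Z f \<in> Cb Z"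
proof -
  obtain B where B: "0 < B" "\<And>z. z \<in> topspace Z \<Longrightarrow> norm (f z) \<le> B"
    using assms Cb_bound by metis
  have "continuous_map Z euclidean ((\<lambda>w::'k. of_real ((norm w)\<^sup>2) / w) \<circ> f)"
    using assms continuous_on_norm_square_divide
    by (intro continuous_map_compose) (auto simp: mem_Cb)
  then show ?thesis
    unfolding Cb_conj_def
    by (intro Cb_restrictI[where B=B]) (use B in \<open>auto simp: o_def norm_divide norm_mult power2_eq_square\<close>)
qed

lemma compactin_positive_lower_bound:
  fixes r :: "'a \<Rightarrow> real"
  assumes "compactin Z K" "continuous_map Z euclidean r" "\<And>z. z \<in> K \<Longrightarrow> 0 < r z"
  obtains \<delta> where "0 < \<delta>" "\<And>z. z \<in> K \<Longrightarrow> \<delta> \<le> r z"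
proof (cases "K = {}")
  case False
  have "compact (r ` K)"
    using image_compactin[OF assms(1,2)] by simp
  then obtain s where "s \<in> r ` K" "\<And>t. t \<in> r ` K \<Longrightarrow> s \<le> t"
    using compact_attains_inf[of "r ` K"] False by auto
  then show ?thesis using that assms(3) by blast
qed (use that[of 1] in auto)

lemma Cb_conj_in_Cc:
  assumes "f \<in> Cc Z"
  shows "Cb_conj Z f \<in> Cc Z"
proof (rule Cc_I2[OF assms])
  show "Cb_conj Z f \<in> Cb Z" using assms by (simp add: Cc_def Cb_conj_in_Cb)
  show "Coz Z (Cb_conj Z f) \<subseteq> supp Z f"
    using Coz_subset_supp[of Z f] by (auto simp: Coz_def Cb_conj_def)
qed

text \<open>If the kernel of the functional had no common zero, finitely many of its elements would have no
  common zero on the support of \<open>f0\<close>, and \<open>f0\<close> would be a multiple of their sum of squares.\<close>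

lemma multiplicative_functional_Cc_eq_evaluation:
  fixes \<phi> :: "('z \<Rightarrow> 'k::real_normed_field) \<Rightarrow> 'k"
  assumes Z: "locally_compact_space Z" "Hausdorff_space Z"
    and add: "\<And>f g. \<lbrakk>f \<in> Cc Z; g \<in> Cc Z\<rbrakk> \<Longrightarrow> \<phi> (\<lambda>z\<in>topspace Z. f z + g z) = \<phi> f + \<phi> g"
    and scale: "\<And>c f. f \<in> Cc Z \<Longrightarrow> \<phi> (\<lambda>z\<in>topspace Z. c * f z) = c * \<phi> f"
    and mult: "\<And>f g. \<lbrakk>f \<in> Cc Z; g \<in> Cc Z\<rbrakk> \<Longrightarrow> \<phi> (\<lambda>z\<in>topspace Z. f z * g z) = \<phi> f * \<phi> g"
    and f0: "f0 \<in> Cc Z" "\<phi> f0 \<noteq> 0"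
  obtains z where "z \<in> topspace Z" "\<And>f. f \<in> Cc Z \<Longrightarrow> \<phi> f = f z"
proof -
  have "\<exists>z\<in>topspace Z. \<forall>f\<in>Cc Z. \<phi> f = 0 \<longrightarrow> f z = 0"
  proof (rule ccontr)
    assume "\<not> ?thesis"
    then have nz: "\<And>z. z \<in> topspace Z \<Longrightarrow> \<exists>f\<in>Cc Z. \<phi> f = 0 \<and> f z \<noteq> 0" by blast
    let ?K = "supp Z f0" and ?ker = "{f \<in> Cc Z. \<phi> f = 0}"
    have K: "compactin Z ?K" using f0 by (simp add: Cc_def)
    have "?K \<subseteq> \<Union> (Coz Z ` ?ker)"
    proof
      fix z assume "z \<in> ?K"
      then have "z \<in> topspace Z" using compactin_subset_topspace[OF K] by blast
      with nz obtain f where "f \<in> ?ker" "z \<in> Coz Z f" unfolding Coz_def by blast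
      then show "z \<in> \<Union> (Coz Z ` ?ker)" by blast
    qed
    moreover have "\<And>U. U \<in> Coz Z ` ?ker \<Longrightarrow> openin Z U"
      by (auto simp: Cc_def intro: openin_Coz)
    ultimately obtain \<F> where "finite \<F>" "\<F> \<subseteq> Coz Z ` ?ker" "?K \<subseteq> \<Union>\<F>"
      using compactinD[OF K, of "Coz Z ` ?ker"] by blast
    from finite_subset_image[OF this(1,2)] obtain F where "F \<subseteq> ?ker" "finite F" "\<F> = Coz Z ` F"
      by blast
    with \<open>?K \<subseteq> \<Union>\<F>\<close> have F: "finite F" "F \<subseteq> ?ker" "?K \<subseteq> \<Union> (Coz Z ` F)"
      by simp_all
    \<comment> \<open>The cozero sets of \<open>F\<close> cover the support of \<open>f0\<close>, so
      \<open>r\<close> is positive there.\<close>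
    define r where "r = (\<lambda>z. \<Sum>f\<in>F. (norm (f z))\<^sup>2)"
    \<comment> \<open>Each summand is \<open>f * Cb_conj Z f\<close>, whose first factor is in the
      kernel, and the kernel is closed under sums.\<close>
    have rker: "(\<lambda>z\<in>topspace Z. of_real (\<Sum>f\<in>F. (norm (f z))\<^sup>2)) \<in> ?ker"
      using F(1,2)
    proof (induction F)
      case empty
      have "(\<lambda>z\<in>topspace Z. 0 * f0 z) \<in> ?ker"
        using Cc_scale[OF f0(1), of 0] scale[OF f0(1), of 0] by simp
      then show ?case by (simp add: restrict_def)
    next
      case (insert f F)
      then have f: "f \<in> Cc Z" "\<phi> f = 0" by auto
      let ?s = "(\<lambda>z\<in>topspace Z. of_real (\<Sum>f\<in>F. (norm (f z))\<^sup>2)) :: 'z \<Rightarrow> 'k"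
      let ?fc = "(\<lambda>z\<in>topspace Z. f z * Cb_conj Z f z)"
      have conj: "Cb_conj Z f \<in> Cc Z" by (rule Cb_conj_in_Cc[OF f(1)])
      then have fc: "?fc \<in> Cc Z"
        by (intro Cc_mult[OF f(1)]) (simp add: Cc_def)
      have fc0: "\<phi> ?fc = 0" by (simp add: mult[OF f(1) conj] f(2))
      have "?s \<in> ?ker" using insert.IH insert.prems by blast
      then have s: "?s \<in> Cc Z" "\<phi> ?s = 0" by blast+
      have "(\<lambda>z\<in>topspace Z. ?fc z + ?s z) \<in> ?ker"
        using Cc_add[OF fc s(1)] add[OF fc s(1)] fc0 s(2) by simp
      moreover have "(\<lambda>z\<in>topspace Z. ?fc z + ?s z)
          = (\<lambda>z\<in>topspace Z. of_real (\<Sum>f\<in>insert f F. (norm (f z))\<^sup>2))"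
        using insert.hyps by (intro restrict_ext) (simp add: Cb_conj_def)
      ultimately show ?case by metis
    qed
    let ?h = "(\<lambda>z\<in>topspace Z. of_real (r z)) :: 'z \<Rightarrow> 'k"
    have h: "?h \<in> Cc Z" "\<phi> ?h = 0" using rker by (simp_all add: r_def)
    have rcont: "continuous_map Z euclidean r"
      unfolding r_def using F(1,2)
      by (intro continuous_map_sum continuous_map_real_pow continuous_map_norm)
         (auto simp: Cc_def mem_Cb)
    have rpos: "0 < r z" if z: "z \<in> ?K" for z
    proof -
      obtain f where "f \<in> F" "f z \<noteq> 0" using F(3) z by (auto simp: Coz_def)
      then show ?thesis unfolding r_def using F(1) by (intro sum_pos2[of F f]) auto
    qed
    obtain \<delta> where \<delta>: "0 < \<delta>" "\<And>z. z \<in> ?K \<Longrightarrow> \<delta> \<le> r z"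
      using compactin_positive_lower_bound[OF K rcont rpos] by blast
    \<comment> \<open>On the support of \<open>f0\<close> this is the reciprocal of
      \<open>r\<close>; the maximum with \<open>\<delta>\<close> keeps it bounded and continuous
      elsewhere.\<close>
    let ?w = "(\<lambda>z\<in>topspace Z. of_real (1 / max (r z) \<delta>)) :: 'z \<Rightarrow> 'k"
    have w: "?w \<in> Cb Z"
    proof (rule Cb_restrictI[where B="1/\<delta>"])
      have "continuous_map Z euclidean (\<lambda>z. max (r z) \<delta>)"
        using rcont by (intro continuous_map_real_max) auto
      then show "continuous_map Z euclidean (\<lambda>z. of_real (1 / max (r z) \<delta>) :: 'k)"
        using \<delta>(1) unfolding continuous_map_atin limitin_canonical_iff
        by (intro ballI tendsto_of_real tendsto_divide tendsto_const) auto
      show "norm (of_real (1 / max (r z) \<delta>) :: 'k) \<le> 1/\<delta>" for z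
        unfolding norm_of_real using \<delta>(1) by (auto simp: field_simps max_def)
    qed
    let ?g = "(\<lambda>z\<in>topspace Z. f0 z * ?w z)"
    have g: "?g \<in> Cc Z" by (rule Cc_mult[OF f0(1) w])
    \<comment> \<open>Off the support both sides vanish with \<open>f0\<close>. The factor 1 brings
      the right side into the form of \<open>scale\<close>.\<close>
    have "(\<lambda>z\<in>topspace Z. ?g z * ?h z) = (\<lambda>z\<in>topspace Z. 1 * f0 z)"
    proof (rule restrict_ext)
      fix z assume z: "z \<in> topspace Z"
      show "?g z * ?h z = 1 * f0 z"
      proof (cases "z \<in> ?K")
        case True
        then show ?thesis using z \<delta>(2)[of z] rpos[OF True] by (simp add: max_def)
      next
        case False
        then show ?thesis using z Coz_subset_supp[of Z f0] by (auto simp: Coz_def)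
      qed
    qed
    then have "\<phi> ?g * \<phi> ?h = 1 * \<phi> f0"
      by (metis mult[OF g h(1)] scale[OF f0(1)])
    then show False using h(2) f0(2) by simp
  qed
  then obtain z where z: "z \<in> topspace Z" "\<And>f. \<lbrakk>f \<in> Cc Z; \<phi> f = 0\<rbrakk> \<Longrightarrow> f z = 0" by auto
  \<comment> \<open>The combination of \<open>f\<close> and \<open>f0\<close> that \<phi>
    annihilates vanishes at the common zero \<open>z\<close>.\<close>
  have proportional: "\<phi> f0 * f z = \<phi> f * f0 z" if f: "f \<in> Cc Z" for f
  proof -
    let ?a = "(\<lambda>z\<in>topspace Z. \<phi> f0 * f z)" and ?b = "(\<lambda>z\<in>topspace Z. (- \<phi> f) * f0 z)"
    have ab: "?a \<in> Cc Z" "?b \<in> Cc Z" by (intro Cc_scale f f0(1))+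
    have "\<phi> (\<lambda>z\<in>topspace Z. ?a z + ?b z) = 0"
      unfolding add[OF ab] scale[OF f] scale[OF f0(1)] by simp
    then have "(\<lambda>z\<in>topspace Z. ?a z + ?b z) z = 0"
      by (rule z(2)[OF Cc_add[OF ab]])
    then show ?thesis using z(1) by simp
  qed
  obtain f1 :: "'z \<Rightarrow> 'k" where "f1 \<in> Cc Z" "f1 z = 1"
    by (rule Cc_separation[OF Z openin_topspace z(1)])
  then have nz: "f0 z \<noteq> 0" using proportional[of f1] f0(2) by auto
  have "f0 \<in> Cb Z" using f0(1) by (simp add: Cc_def)
  \<comment> \<open>Proportionality for the square of \<open>f0\<close> reads
    \<open>\<phi> f0 * (f0 z * f0 z) = \<phi> f0 * \<phi> f0 * f0 z\<close>; cancelling the nonzero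
    factors fixes the constant of proportionality as 1.\<close>
  from proportional[OF Cc_mult[OF f0(1) this]] have "\<phi> f0 = f0 z"
    using nz f0 z(1) mult[OF f0(1) f0(1)] by simp
  then have "\<phi> f = f z" if "f \<in> Cc Z" for f
    using proportional[OF that] nz by simp
  then show ?thesis by (rule that[OF z(1)])
qed

text \<open>For fixed \<open>y\<close> the functional \<open>\<lambda>f. T f y\<close> is
  multiplicative, hence evaluation at some point \<open>s y\<close>. Continuity of \<open>s\<close>
  follows because \<open>f (s y) = T f y\<close> makes the preimage of a cozero set again a cozero
  set.\<close>

lemma Cc_multiplicative_map_eq_composition:
  fixes T :: "('z \<Rightarrow> 'k::real_normed_field) \<Rightarrow> ('y \<Rightarrow> 'k)"
  assumes Z: "locally_compact_space Z" "Hausdorff_space Z"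
    and Y: "locally_compact_space Y" "Hausdorff_space Y"
    and iso: "isometric_isomorphism Z (Cc Z) Y (Cc Y) T"
  obtains s where "continuous_map Y Z s"
    "\<And>f y. \<lbrakk>f \<in> Cc Z; y \<in> topspace Y\<rbrakk> \<Longrightarrow> T f y = f (s y)"
proof -
  have T: "T ` Cc Z = Cc Y" 
    "\<And>f g. \<lbrakk>f \<in> Cc Z; g \<in> Cc Z\<rbrakk> \<Longrightarrow> T (\<lambda>x\<in>topspace Z. f x + g x) = (\<lambda>y\<in>topspace Y. T f y + T g y)"
    "\<And>c f. f \<in> Cc Z \<Longrightarrow> T (\<lambda>x\<in>topspace Z. c * f x) = (\<lambda>y\<in>topspace Y. c * T f y)"
    "\<And>f g. \<lbrakk>f \<in> Cc Z; g \<in> Cc Z\<rbrakk> \<Longrightarrow> T (\<lambda>x\<in>topspace Z. f x * g x) = (\<lambda>y\<in>topspace Y. T f y * T g y)"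
    using iso by (simp_all add: isometric_isomorphism_def bij_betw_def)
  have "\<exists>z\<in>topspace Z. \<forall>f\<in>Cc Z. T f y = f z" if y: "y \<in> topspace Y" for y
  proof -
    obtain g :: "'y \<Rightarrow> 'k" where g: "g \<in> Cc Y" "g y = 1"
      by (rule Cc_separation[OF Y openin_topspace y])
    \<comment> \<open>Surjectivity of \<open>T\<close> shows that the functional is not
      zero.\<close>
    then obtain f0 where f0: "f0 \<in> Cc Z" "g = T f0"
      using T(1) by blast
    obtain z where "z \<in> topspace Z" "\<And>f. f \<in> Cc Z \<Longrightarrow> T f y = f z"
      by (rule multiplicative_functional_Cc_eq_evaluation[OF Z, of "\<lambda>f. T f y" f0])
         (use T(2-4) y f0 g in simp_all)
    then show ?thesis by blast
  qed
  then obtain s where s: "\<And>y. y \<in> topspace Y \<Longrightarrow> s y \<in> topspace Z"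
    "\<And>f y. \<lbrakk>f \<in> Cc Z; y \<in> topspace Y\<rbrakk> \<Longrightarrow> T f y = f (s y)" by metis
  have "openin Y {y \<in> topspace Y. s y \<in> U}" if U: "openin Z U" for U
  proof (subst openin_subopen, intro ballI)
    fix y assume "y \<in> {y \<in> topspace Y. s y \<in> U}"
    then have y: "y \<in> topspace Y" "s y \<in> U" by auto
    obtain f :: "'z \<Rightarrow> 'k" where f: "f \<in> Cc Z" "f (s y) = 1" "Coz Z f \<subseteq> U"
      by (rule Cc_separation[OF Z U y(2)])
    have "T f \<in> Cc Y" using f(1) T(1) by blast
    then have "openin Y (Coz Y (T f))" by (simp add: Cc_def openin_Coz)
    moreover have "y \<in> Coz Y (T f)" using f y s by (simp add: Coz_def)
    moreover have "Coz Y (T f) \<subseteq> {y \<in> topspace Y. s y \<in> U}"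
      using f(1,3) s by (auto simp: Coz_def subset_iff)
    ultimately show "\<exists>T. openin Y T \<and> y \<in> T \<and> T \<subseteq> {y \<in> topspace Y. s y \<in> U}" by blast
  qed
  then have "continuous_map Y Z s" using s(1) by (auto simp: continuous_map_def)
  then show ?thesis using s(2) by (rule that)
qed

text \<open>By injectivity, \<open>inv_into A T h\<close> is any element of \<open>A\<close> that
  \<open>T\<close> maps to \<open>h\<close>. Closure of \<open>A\<close> under the operations
  ensures that the expected sums, multiples and products are such elements.\<close>

lemma isometric_isomorphism_inverse:
  assumes iso: "isometric_isomorphism X A Y B T"
    and add: "\<And>f g. \<lbrakk>f \<in> A; g \<in> A\<rbrakk> \<Longrightarrow> (\<lambda>x\<in>topspace X. f x + g x) \<in> A"
    and scale: "\<And>c f. f \<in> A \<Longrightarrow> (\<lambda>x\<in>topspace X. c * f x) \<in> A"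
    and mult: "\<And>f g. \<lbrakk>f \<in> A; g \<in> A\<rbrakk> \<Longrightarrow> (\<lambda>x\<in>topspace X. f x * g x) \<in> A"
  shows "isometric_isomorphism Y B X A (inv_into A T)"
proof -
  have bij: "bij_betw T A B" using iso by (simp add: isometric_isomorphism_def)
  have inv: "inv_into A T g \<in> A" "T (inv_into A T g) = g" if "g \<in> B" for g
    using bij that by (auto simp: bij_betw_def inv_into_into f_inv_into_f)
  have eq: "inv_into A T h = f" if "f \<in> A" "T f = h" for f h
    using bij that by (auto simp: bij_betw_def)
  show ?thesis
    unfolding isometric_isomorphism_def
  proof (intro conjI ballI allI)
    show "bij_betw (inv_into A T) B A" by (rule bij_betw_inv_into[OF bij])
  next
    fix f g assume fg: "f \<in> B" "g \<in> B"
    show "inv_into A T (\<lambda>x\<in>topspace Y. f x + g x)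
        = (\<lambda>y\<in>topspace X. inv_into A T f y + inv_into A T g y)"
      using iso inv[OF fg(1)] inv[OF fg(2)]
      by (intro eq add) (simp_all add: isometric_isomorphism_def)
    show "inv_into A T (\<lambda>x\<in>topspace Y. f x * g x)
        = (\<lambda>y\<in>topspace X. inv_into A T f y * inv_into A T g y)"
      using iso inv[OF fg(1)] inv[OF fg(2)]
      by (intro eq mult) (simp_all add: isometric_isomorphism_def)
  next
    fix c f assume f: "f \<in> B"
    show "inv_into A T (\<lambda>x\<in>topspace Y. c * f x) = (\<lambda>y\<in>topspace X. c * inv_into A T f y)"
      using iso inv[OF f] by (intro eq scale) (simp_all add: isometric_isomorphism_def)
  next
    fix f assume f: "f \<in> B"
    show "sup_norm X (inv_into A T f) = sup_norm Y f"
      using iso inv[OF f] by (metis isometric_isomorphism_def)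
  qed
qed

lemma isometric_isomorphism_compose:
  assumes T: "isometric_isomorphism X A Y B T" and S: "isometric_isomorphism Y B Z C S"
  shows "isometric_isomorphism X A Z C (S \<circ> T)"
proof -
  have "T f \<in> B" if "f \<in> A" for f
    using T that by (auto simp: isometric_isomorphism_def bij_betw_def)
  then show ?thesis
    using T S bij_betw_trans[of T A B S C] unfolding isometric_isomorphism_def by simp
qed

lemma Cc_eq_at_imp_eq:
  assumes "locally_compact_space Z" "Hausdorff_space Z" "z \<in> topspace Z" "z' \<in> topspace Z"
    and eq: "\<And>f. f \<in> (Cc Z :: ('z \<Rightarrow> 'k::real_normed_field) set) \<Longrightarrow> f z = f z'"
  shows "z = z'"
proof (rule ccontr)
  assume "z \<noteq> z'"
  moreover have "openin Z (topspace Z - {z'})"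
    using Hausdorff_imp_t1_space[OF assms(2)] openin_topspace
    unfolding t1_space_openin_delete_alt by blast
  ultimately obtain f :: "'z \<Rightarrow> 'k" where f: "f \<in> Cc Z" "f z = 1" "Coz Z f \<subseteq> topspace Z - {z'}"
    using Cc_separation[of Z "topspace Z - {z'}" z] assms(1-3) by blast
  then have "f z' = 0" using assms(4) by (auto simp: Coz_def)
  with f eq[OF f(1)] show False by simp
qed

text \<open>Both \<open>T\<close> and its inverse are compositions with continuous maps
  \<open>s\<close> and \<open>t\<close>. Then \<open>f (s (t z)) = f z\<close> for all
  \<open>f\<close> in \<open>Cc Z\<close>, and likewise on \<open>Y\<close>; since these functions
  separate points, \<open>s\<close> and \<open>t\<close> are mutually inverse.\<close>

theorem isometric_isomorphism_Cc_imp_homeomorphic_space: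
  fixes T :: "('z \<Rightarrow> 'k::real_normed_field) \<Rightarrow> ('y \<Rightarrow> 'k)"
  assumes Z: "locally_compact_space Z" "Hausdorff_space Z"
    and Y: "locally_compact_space Y" "Hausdorff_space Y"
    and iso: "isometric_isomorphism Z (Cc Z) Y (Cc Y) T"
  shows "Z homeomorphic_space Y"
proof -
  define T' where "T' = inv_into (Cc Z) T"
  have iso': "isometric_isomorphism Y (Cc Y) Z (Cc Z) T'"
    unfolding T'_def using iso
    by (rule isometric_isomorphism_inverse) (auto simp: Cc_add Cc_scale intro: Cc_mult subsetD[OF Cc_subset_Cb])
  obtain s where s: "continuous_map Y Z s"
    "\<And>f y. \<lbrakk>f \<in> Cc Z; y \<in> topspace Y\<rbrakk> \<Longrightarrow> T f y = f (s y)"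
    by (rule Cc_multiplicative_map_eq_composition[OF Z Y iso]) (rule that)
  obtain t where t: "continuous_map Z Y t"
    "\<And>f z. \<lbrakk>f \<in> Cc Y; z \<in> topspace Z\<rbrakk> \<Longrightarrow> T' f z = f (t z)"
    by (rule Cc_multiplicative_map_eq_composition[OF Y Z iso']) (rule that)
  have bij: "bij_betw T (Cc Z) (Cc Y)" using iso by (simp add: isometric_isomorphism_def)
  have im: "s y \<in> topspace Z" if "y \<in> topspace Y" for y
    using continuous_map_funspace[OF s(1)] that by auto
  have im': "t z \<in> topspace Y" if "z \<in> topspace Z" for z
    using continuous_map_funspace[OF t(1)] that by auto
  have "s (t z) = z" if z: "z \<in> topspace Z" for z
  proof (rule Cc_eq_at_imp_eq[OF Z im[OF im'[OF z]] z])
    fix f :: "'z \<Rightarrow> 'k" assume f: "f \<in> Cc Z"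
    have "T f \<in> Cc Y" "T' (T f) = f" using f bij by (auto simp: T'_def bij_betw_def)
    then show "f (s (t z)) = f z" using s(2)[OF f im'[OF z]] t(2)[of "T f" z] z by simp
  qed
  moreover have "t (s y) = y" if y: "y \<in> topspace Y" for y
  proof (rule Cc_eq_at_imp_eq[OF Y im'[OF im[OF y]] y])
    fix f :: "'y \<Rightarrow> 'k" assume f: "f \<in> Cc Y"
    have "T' f \<in> Cc Z" "T (T' f) = f"
      using f bij by (auto simp: T'_def bij_betw_def inv_into_into f_inv_into_f)
    then show "f (t (s y)) = f y" using t(2)[OF f im[OF y]] s(2)[of "T' f" y] y by simp
  qed
  ultimately show ?thesis
    using s(1) t(1) unfolding homeomorphic_space_def homeomorphic_maps_def by blast
qed


subsection \<open>Extension to the Stone--Cech compactification\<close>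

lemma mem_unit_maps:
  "g \<in> unit_maps X \<longleftrightarrow> continuous_map X (top_of_set {0..1}) g \<and> g \<in> extensional (topspace X)"
proof -
  have "bounded (g ` topspace X)" if "g \<in> topspace X \<rightarrow> {0..1::real}"
    using bounded_subset[OF bounded_closed_interval funcset_image[OF that]] .
  then show ?thesis
    unfolding unit_maps_def mspace_submetric mspace_cfunspace continuous_map_in_subtopology
    by auto
qed

lemma embedding_map_in_closure_of_image_iff:
  assumes "embedding_map X Y f" "S \<subseteq> topspace X" "x \<in> topspace X"
  shows "f x \<in> Y closure_of (f ` S) \<longleftrightarrow> x \<in> X closure_of S"
proof -
  have hom: "homeomorphic_map X (subtopology Y (f ` topspace X)) f"
    using assms(1) by (simp add: embedding_map_def)
  have "f ` topspace X \<inter> (Y closure_of (f ` S)) = f ` (X closure_of S)"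
    using homeomorphic_map_closure_of[OF hom assms(2)] image_mono[OF assms(2), of f]
    by (simp add: closure_of_subtopology Int_absorb1)
  moreover have "inj_on f (topspace X)"
    using hom by (simp add: homeomorphic_map_def)
  ultimately show ?thesis
    using assms(3) closure_of_subset_topspace[of X S] inj_on_image_mem_iff[of f "topspace X" x]
    by blast
qed

text \<open>The image of \<open>K\<close> is compact, hence closed in a Hausdorff space, and it is
  dense, so the embedding is onto.\<close>

lemma beta_embed_compact_space_homeomorphic_map:
  assumes "compact_space K" "Hausdorff_space K"
  shows "homeomorphic_map K (stone_cech K) (beta_embed K)"
proof -
  have "completely_regular_space K"
    using assms by (simp add: compact_imp_locally_compact_space
        locally_compact_Hausdorff_imp_regular_space locally_compact_regular_imp_completely_regular_space)
  then have emb: "embedding_map K (stone_cech K) (beta_embed K)"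
    using assms by (simp add: embedding_map_beta_embed)
  then have "continuous_map K (stone_cech K) (beta_embed K)"
    unfolding embedding_map_def
    by (rule continuous_map_into_fulltopology[OF homeomorphic_imp_continuous_map])
  then have "compactin (stone_cech K) (beta_embed K ` topspace K)"
    using assms(1) unfolding compact_space_def by (rule image_compactin[rotated])
  then have "beta_embed K ` topspace K = topspace (stone_cech K)"
    by (metis Hausdorff_space_stone_cech closure_of_closedin compactin_imp_closedin stone_cech_dense)
  with emb show ?thesis by (simp add: embedding_map_def)
qed

text \<open>The closure \<open>K\<close> of the range is compact, so it coincides with its
  Stone--Cech compactification. The extension is the map induced by \<open>f\<close> between the
  compactifications, followed by the inverse of \<open>beta_embed K\<close>.\<close>

lemma stone_cech_extension_heine_borel:
  fixes f :: "'a \<Rightarrow> 'k::heine_borel"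
  assumes f: "continuous_map X euclidean f" and bdd: "bounded (f ` topspace X)"
  obtains F where "continuous_map (stone_cech X) euclidean F"
    "\<And>x. x \<in> topspace X \<Longrightarrow> F (beta_embed X x) = f x"
proof -
  define K where "K = top_of_set (closure (f ` topspace X))"
  have K: "compact_space K" "Hausdorff_space K"
    unfolding K_def using bdd
    by (simp_all add: compact_space_subtopology Hausdorff_space_subtopology compact_closure)
  have fK: "continuous_map X K f"
    unfolding K_def using f closure_subset[of "f ` topspace X"]
    by (auto simp: continuous_map_in_subtopology)
  obtain r where r: "homeomorphic_maps K (stone_cech K) (beta_embed K) r"
    using beta_embed_compact_space_homeomorphic_map[OF K] unfolding homeomorphic_map_maps by blast
  let ?cube = "product_topology (\<lambda>g. top_of_set {0..1::real}) (unit_maps K)"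
  \<comment> \<open>The coordinate at \<open>g\<close> is read off at the index
    \<open>g \<circ> f\<close>, restricted so as to be extensional.\<close>
  define \<Phi> where "\<Phi> = (\<lambda>p. \<lambda>g\<in>unit_maps K. p (\<lambda>x\<in>topspace X. g (f x)) :: real)"
  have gf: "(\<lambda>x\<in>topspace X. g (f x)) \<in> unit_maps X" if "g \<in> unit_maps K" for g
  proof -
    have "continuous_map X (top_of_set {0..1}) (g \<circ> f)"
      using fK that continuous_map_compose unfolding mem_unit_maps by blast
    then show ?thesis
      by (auto simp: mem_unit_maps intro: continuous_map_eq)
  qed
  have \<Phi>: "continuous_map (stone_cech X) ?cube \<Phi>"
    unfolding continuous_map_componentwise
  proof (intro conjI ballI)
    show "\<Phi> ` topspace (stone_cech X) \<subseteq> extensional (unit_maps K)"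
      by (auto simp: \<Phi>_def)
    fix g assume g: "g \<in> unit_maps K"
    have "continuous_map (stone_cech X) (top_of_set {0..1}) (\<lambda>p. p (\<lambda>x\<in>topspace X. g (f x)))"
      unfolding stone_cech_def Let_def
      by (rule continuous_map_from_subtopology[OF continuous_map_product_projection[OF gf[OF g]]])
    then show "continuous_map (stone_cech X) (top_of_set {0..1}) (\<lambda>p. \<Phi> p g)"
      using g by (simp add: \<Phi>_def)
  qed
  have \<Phi>e: "\<Phi> (beta_embed X x) = beta_embed K (f x)" if "x \<in> topspace X" for x
    using that gf unfolding \<Phi>_def beta_embed_def by (intro restrict_ext) simp
  \<comment> \<open>A priori \<Phi> has values in the cube; continuity and density of the image of
    \<open>X\<close> keep them in the closure of the image of \<open>K\<close>.\<close>
  have "\<Phi> ` topspace (stone_cech X) \<subseteq> ?cube closure_of (\<Phi> ` (beta_embed X ` topspace X))"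
    using continuous_map_image_closure_subset[OF \<Phi>] stone_cech_dense[of X] by metis
  also have "\<dots> \<subseteq> ?cube closure_of (beta_embed K ` topspace K)"
    using \<Phi>e continuous_map_funspace[OF fK] by (intro closure_of_mono) auto
  finally have "continuous_map (stone_cech X) (stone_cech K) \<Phi>"
    using \<Phi> by (auto simp: stone_cech_def[of K] Let_def continuous_map_in_subtopology)
  then have "continuous_map (stone_cech X) K (r \<circ> \<Phi>)"
    using r by (auto simp: homeomorphic_maps_def intro: continuous_map_compose)
  then have "continuous_map (stone_cech X) euclidean (r \<circ> \<Phi>)"
    by (simp add: K_def continuous_map_in_subtopology)
  moreover have "(r \<circ> \<Phi>) (beta_embed X x) = f x" if "x \<in> topspace X" for x
    using that \<Phi>e r continuous_map_funspace[OF fK] by (auto simp: homeomorphic_maps_def)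
  ultimately show ?thesis by (rule that)
qed


subsection \<open>The space \<open>lambda_P\<close>\<close>

text \<open>Finitely many open sets, each meeting only finitely many members of the family, cover
  \<open>K\<close>.\<close>

lemma locally_finite_in_meets_compactin_finite:
  assumes "locally_finite_in Z \<V>" "compactin Z K"
  shows "finite {V \<in> \<V>. V \<inter> K \<noteq> {}}"
proof -
  let ?\<W> = "{W. openin Z W \<and> finite {V \<in> \<V>. V \<inter> W \<noteq> {}}}"
  have "K \<subseteq> \<Union>?\<W>"
    using assms(1) compactin_subset_topspace[OF assms(2)] unfolding locally_finite_in_def by blast
  then obtain \<F> where \<F>: "finite \<F>" "\<F> \<subseteq> ?\<W>" "K \<subseteq> \<Union>\<F>"
    using compactinD[OF assms(2), of ?\<W>] by blast
  have "finite (\<Union>W\<in>\<F>. {V \<in> \<V>. V \<inter> W \<noteq> {}})"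
    using \<F>(1,2) by (intro finite_UN_I) auto
  moreover have "{V \<in> \<V>. V \<inter> K \<noteq> {}} \<subseteq> (\<Union>W\<in>\<F>. {V \<in> \<V>. V \<inter> W \<noteq> {}})"
    using \<F>(3) by blast
  ultimately show ?thesis by (rule rev_finite_subset)
qed

section \<open>Closed subspaces having \<open>P\<close>\<close>

locale closed_sum_property =
  fixes P :: "'a topology \<Rightarrow> bool" and X :: "'a topology"
  assumes closed_hereditary: "closed_hereditary P"
    and closed_sums: "preserved_under_countable_closed_sums P"
    and nonempty: "topspace X \<noteq> {}" and normal: "normal_space X" and Hausdorff: "Hausdorff_space X"
    and locally_P: "locally_P_space P X"
    and closure_neighbourhood: "\<And>S. \<lbrakk>S \<subseteq> topspace X; P (subtopology X S)\<rbrakk>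
          \<Longrightarrow> \<exists>N. P_neighbourhood P X (X closure_of S) N"
begin

definition P_closed :: "'a set \<Rightarrow> bool" where
  "P_closed D \<longleftrightarrow> closedin X D \<and> P (subtopology X D)"

lemma P_closed_subset:
  assumes "P (subtopology X D)" "closedin X E" "E \<subseteq> D"
  shows "P_closed E"
proof -
  have "closedin (subtopology X D) E"
    using assms(2,3) by (rule closedin_subset_topspace)
  then have "P (subtopology (subtopology X D) E)"
    using closed_hereditary[unfolded closed_hereditary_def, rule_format] assms(1) by simp
  then show ?thesis
    using assms(2,3) by (simp add: P_closed_def subtopology_subtopology Int_absorb1)
qed

text \<open>The closure has a \<open>P\<close>-neighbourhood and is closed in it, so closed heredity
  applies.\<close>

lemma P_closed_closure_of:
  assumes "S \<subseteq> topspace X" "P (subtopology X S)"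
  shows "P_closed (X closure_of S)"
proof -
  obtain N where N: "P_neighbourhood P X (X closure_of S) N"
    using closure_neighbourhood[OF assms] by blast
  then have "X closure_of S \<subseteq> N"
    using interior_of_subset[of X N] unfolding P_neighbourhood_def by blast
  then show ?thesis
    using N P_closed_subset[of N] by (simp add: P_neighbourhood_def)
qed

text \<open>Each member is closed in the subspace \<open>\<Union>\<C>\<close>, which therefore has
  \<open>P\<close> as a countable closed sum. It may fail to be closed in \<open>X\<close>, hence
  the passage to the closure.\<close>

lemma P_closed_closure_Union:
  assumes "countable \<C>" "\<And>C. C \<in> \<C> \<Longrightarrow> P_closed C"
  shows "P_closed (X closure_of \<Union>\<C>)"
proof (rule P_closed_closure_of)
  show sub: "\<Union>\<C> \<subseteq> topspace X"
    using assms(2) by (auto simp: P_closed_def dest: closedin_subset)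
  have "closedin (subtopology X (\<Union>\<C>)) C \<and> P (subtopology (subtopology X (\<Union>\<C>)) C)"
    if "C \<in> \<C>" for C
  proof -
    have "C \<subseteq> \<Union>\<C>" using that by blast
    then show ?thesis
      using assms(2)[OF that]
      by (simp add: P_closed_def closedin_subset_topspace subtopology_subtopology Int_absorb1)
  qed
  moreover have "\<Union>\<C> = topspace (subtopology X (\<Union>\<C>))"
    using sub by auto
  ultimately show "P (subtopology X (\<Union>\<C>))"
    using closed_sums[unfolded preserved_under_countable_closed_sums_def, rule_format,
        of \<C> "subtopology X (\<Union>\<C>)"] assms(1) by simp
qed

lemma P_closed_point:
  assumes "x \<in> topspace X"
  obtains D where "P_closed D" "x \<in> D"
proof -
  obtain N where N: "P_neighbourhood P X {x} N"
    using locally_P assms unfolding locally_P_space_def by blast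
  then have "P_closed (X closure_of N)"
    by (auto simp: P_neighbourhood_def intro: P_closed_closure_of)
  moreover have "x \<in> X closure_of N"
    using N interior_of_subset[of X N] closure_of_subset[of N X]
    by (auto simp: P_neighbourhood_def)
  ultimately show ?thesis by (rule that)
qed

text \<open>Normality separates \<open>D\<close> from the complement of the interior of a
  \<open>P\<close>-neighbourhood \<open>N\<close>. The cozero set then lies in \<open>N\<close>, and
  the closure of \<open>N\<close> again has \<open>P\<close>.\<close>

lemma P_closed_Urysohn:
  assumes "P_closed D"
  obtains g :: "'a \<Rightarrow> real" where "continuous_map X (top_of_set {0..1}) g"
    "\<And>x. x \<in> D \<Longrightarrow> g x = 1" "P_closed (X closure_of {x \<in> topspace X. g x \<noteq> 0})"
proof -
  have D: "closedin X D" "P (subtopology X D)" using assms by (auto simp: P_closed_def)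
  obtain N where "P_neighbourhood P X (X closure_of D) N"
    using closure_neighbourhood[OF closedin_subset[OF D(1)] D(2)] by blast
  then have N: "N \<subseteq> topspace X" "D \<subseteq> X interior_of N" "P (subtopology X N)"
    using D(1) by (simp_all add: P_neighbourhood_def closure_of_closedin)
  have "closedin X (topspace X - X interior_of N)"
    by (rule closedin_diff[OF closedin_topspace openin_interior_of])
  moreover have "disjnt (topspace X - X interior_of N) D"
    using N(2) by (auto simp: disjnt_def)
  ultimately obtain g :: "'a \<Rightarrow> real" where g: "continuous_map X (top_of_set {0..1}) g"
    "g ` (topspace X - X interior_of N) \<subseteq> {0}" "g ` D \<subseteq> {1}"
    by (rule Urysohn_lemma[OF normal _ D(1) _ zero_le_one])
  have "{x \<in> topspace X. g x \<noteq> 0} \<subseteq> N"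
    using g(2) interior_of_subset[of X N] by auto
  then have "X closure_of {x \<in> topspace X. g x \<noteq> 0} \<subseteq> X closure_of N"
    by (rule closure_of_mono)
  moreover have "P (subtopology X (X closure_of N))"
    using P_closed_closure_of[OF N(1,3)] by (simp add: P_closed_def)
  ultimately have "P_closed (X closure_of {x \<in> topspace X. g x \<noteq> 0})"
    by (intro P_closed_subset[OF _ closedin_closure_of])
  moreover have "g x = 1" if "x \<in> D" for x
    using g(3) that by auto
  ultimately show ?thesis
    by (intro that[OF g(1)])
qed

section \<open>Closures in the Stone--Cech compactification\<close>

abbreviation "\<beta> \<equiv> stone_cech X"
abbreviation "e \<equiv> beta_embed X"

lemma embedding: "embedding_map X \<beta> e"
  using Hausdorff normal by (simp add: embedding_map_beta_embed normal_imp_completely_regular_space)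

lemma e_in_closure_iff: "\<lbrakk>closedin X D; x \<in> topspace X\<rbrakk> \<Longrightarrow> e x \<in> \<beta> closure_of (e ` D) \<longleftrightarrow> x \<in> D"
  using embedding_map_in_closure_of_image_iff[OF embedding closedin_subset]
  by (simp add: closure_of_closedin)

lemma continuous_e: "continuous_map X \<beta> e"
  using continuous_map_into_fulltopology[OF homeomorphic_imp_continuous_map]
    embedding[unfolded embedding_map_def] by blast

lemma e_in_beta: "x \<in> topspace X \<Longrightarrow> e x \<in> topspace \<beta>"
  using continuous_map_funspace[OF continuous_e] by auto

text \<open>Density of the image of \<open>X\<close>. This bounds open sets of \<beta> by closures
  of cozero sets and supports in \<open>X\<close>.\<close>

lemma openin_subset_closure_of_trace:
  assumes "openin \<beta> U"
  shows "U \<subseteq> \<beta> closure_of (e ` {x \<in> topspace X. e x \<in> U})"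
proof -
  have "U \<subseteq> topspace \<beta>" by (rule openin_subset[OF assms])
  then have "U \<subseteq> \<beta> closure_of (U \<inter> e ` topspace X)"
    using openin_Int_closure_of_subset[OF assms, of "e ` topspace X"] stone_cech_dense[of X]
    by (simp add: Int_absorb2)
  also have "U \<inter> e ` topspace X = e ` {x \<in> topspace X. e x \<in> U}" by auto
  finally show ?thesis .
qed

text \<open>Normality makes this the carrier of \<open>lambda_P\<close> (\<open>lambda_carrier\<close>), whatever the scalar field.\<close>

definition \<Lambda> :: "(('a \<Rightarrow> real) \<Rightarrow> real) set" where
  "\<Lambda> = \<Union> {\<beta> closure_of (e ` D) | D. P_closed D}"

text \<open>Being below a single closure, not merely inside their union \<Lambda>, makes these sets
  a sigma-ideal (\<open>covered_Union\<close>).\<close>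

definition covered :: "(('a \<Rightarrow> real) \<Rightarrow> real) set \<Rightarrow> bool" where
  "covered S \<longleftrightarrow> (\<exists>D. P_closed D \<and> S \<subseteq> \<beta> closure_of (e ` D))"

lemma P_closed_imp_interior_neighbourhood:
  assumes "P_closed D"
  obtains g :: "'a \<Rightarrow> real" where "continuous_map X (top_of_set {0..1}) g"
    "P_closed (X closure_of {x \<in> topspace X. g x \<noteq> 0})"
    "\<beta> closure_of (e ` D) \<subseteq> \<beta> interior_of (\<beta> closure_of (e ` {x \<in> topspace X. g x \<noteq> 0}))"
proof -
  obtain g :: "'a \<Rightarrow> real" where g: "continuous_map X (top_of_set {0..1}) g"
    "\<And>x. x \<in> D \<Longrightarrow> g x = 1" "P_closed (X closure_of {x \<in> topspace X. g x \<noteq> 0})"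
    using P_closed_Urysohn[OF assms] by blast
  obtain G where G: "continuous_map \<beta> (top_of_set {0..1::real}) G"
    "\<And>x. x \<in> topspace X \<Longrightarrow> G (e x) = g x"
    using stone_cech_extension[OF g(1)] by blast
  have Gc: "continuous_map \<beta> euclidean G" using G(1) by (simp add: continuous_map_in_subtopology)
  define U where "U = {p \<in> topspace \<beta>. G p \<noteq> 0}"
  have U: "openin \<beta> U"
    unfolding U_def using openin_continuous_map_preimage[OF Gc, of "- {0}"] by (simp add: open_Compl)
  have "D \<subseteq> topspace X" using assms by (auto simp: P_closed_def dest: closedin_subset)
  then have "e ` D \<subseteq> {p \<in> topspace \<beta>. G p \<in> {1}}"
    using G(2) g(2) e_in_beta by auto
  moreover have "closedin \<beta> {p \<in> topspace \<beta>. G p \<in> {1}}"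
    using closedin_continuous_map_preimage[OF Gc, of "{1}"] by simp
  ultimately have "\<beta> closure_of (e ` D) \<subseteq> {p \<in> topspace \<beta>. G p \<in> {1}}"
    by (rule closure_of_minimal)
  also have "\<dots> \<subseteq> U" by (auto simp: U_def)
  finally have 1: "\<beta> closure_of (e ` D) \<subseteq> U" .
  have "{x \<in> topspace X. e x \<in> U} = {x \<in> topspace X. g x \<noteq> 0}"
    using G(2) e_in_beta by (auto simp: U_def)
  then have "U \<subseteq> \<beta> closure_of (e ` {x \<in> topspace X. g x \<noteq> 0})"
    using openin_subset_closure_of_trace[OF U] by simp
  then have "U \<subseteq> \<beta> interior_of (\<beta> closure_of (e ` {x \<in> topspace X. g x \<noteq> 0}))"
    using U by (rule interior_of_maximal)
  with 1 show ?thesis using g by (intro that[of g]) auto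
qed

text \<open>For one inclusion \<open>C\<close> is enlarged to its closure. For the other, the real
  function \<open>g\<close> is turned into a scalar function with the same cozero set.\<close>

lemma lambda_carrier:
  "\<Union> {\<beta> interior_of (\<beta> closure_of (e ` C)) | C.
      C \<in> cozero_sets TYPE('k::real_normed_field) X \<and> P (subtopology X (X closure_of C))} = \<Lambda>"
  (is "\<Union> {?I C | C. ?Q C} = _")
proof
  show "\<Union> {?I C | C. ?Q C} \<subseteq> \<Lambda>"
  proof
    fix p assume "p \<in> \<Union> {?I C | C. ?Q C}"
    then obtain C where C: "p \<in> ?I C" "C \<subseteq> topspace X" "P (subtopology X (X closure_of C))"
      by (auto simp: cozero_sets_def Coz_def)
    have "e ` C \<subseteq> e ` (X closure_of C)" using closure_of_subset[OF C(2)] by (rule image_mono)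
    then have "p \<in> \<beta> closure_of (e ` (X closure_of C))"
      by (rule subsetD[OF closure_of_mono subsetD[OF interior_of_subset C(1)]])
    moreover have "P_closed (X closure_of C)" using C by (simp add: P_closed_def)
    ultimately show "p \<in> \<Lambda>" unfolding \<Lambda>_def by blast
  qed
  show "\<Lambda> \<subseteq> \<Union> {?I C | C. ?Q C}"
  proof
    fix p assume "p \<in> \<Lambda>"
    then obtain D where D: "P_closed D" "p \<in> \<beta> closure_of (e ` D)"
      unfolding \<Lambda>_def by blast
    obtain g :: "'a \<Rightarrow> real" where g: "continuous_map X (top_of_set {0..1}) g"
      "P_closed (X closure_of {x \<in> topspace X. g x \<noteq> 0})"
      "\<beta> closure_of (e ` D) \<subseteq> ?I {x \<in> topspace X. g x \<noteq> 0}"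
      by (rule P_closed_imp_interior_neighbourhood[OF D(1)])
    define f where "f = (\<lambda>x\<in>topspace X. of_real (g x) :: 'k)"
    have "f \<in> Cb X"
      unfolding f_def
    proof (rule Cb_restrictI[where B=1])
      show "continuous_map X euclidean (\<lambda>x. of_real (g x) :: 'k)"
        using continuous_map_into_fulltopology[OF g(1)]
        by (simp add: continuous_map_atin tendsto_of_real)
      show "norm (of_real (g x) :: 'k) \<le> 1" if "x \<in> topspace X" for x
        using g(1) that by (auto simp: continuous_map_in_subtopology Pi_iff)
    qed
    moreover have "Coz X f = {x \<in> topspace X. g x \<noteq> 0}"
      by (auto simp: Coz_def f_def)
    ultimately have "{x \<in> topspace X. g x \<noteq> 0} \<in> cozero_sets TYPE('k) X"
      unfolding cozero_sets_def by (intro rev_image_eqI) auto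
    then have "?Q {x \<in> topspace X. g x \<noteq> 0}"
      using g(2) by (simp add: P_closed_def)
    moreover have "p \<in> ?I {x \<in> topspace X. g x \<noteq> 0}"
      using g(3) D(2) by (rule subsetD)
    ultimately show "p \<in> \<Union> {?I C | C. ?Q C}" by blast
  qed
qed

lemma lambda_P_eq: "lambda_P TYPE('k::real_normed_field) P X = subtopology \<beta> \<Lambda>"
  unfolding lambda_P_def lambda_carrier ..

section \<open>The locally compact space \<open>Y\<close>\<close>

definition Y :: "(('a \<Rightarrow> real) \<Rightarrow> real) topology" where
  "Y = subtopology \<beta> \<Lambda>"

lemma closure_subset_\<Lambda>: "P_closed D \<Longrightarrow> \<beta> closure_of (e ` D) \<subseteq> \<Lambda>"
  unfolding \<Lambda>_def by blast

lemma topspace_Y: "topspace Y = \<Lambda>"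
  unfolding Y_def \<Lambda>_def using closure_of_subset_topspace[of \<beta>] by fastforce

text \<open>The description by interiors shows openness; the real scalars serve as one instance of
  it.\<close>

lemma openin_\<Lambda>: "openin \<beta> \<Lambda>"
  unfolding lambda_carrier[where 'k=real, symmetric] by (intro openin_Union) auto

text \<open>Local \<open>P\<close> places each point of \<open>X\<close> in a closed subspace having
  \<open>P\<close>.\<close>

lemma e_in_Y: "x \<in> topspace X \<Longrightarrow> e x \<in> topspace Y"
proof -
  assume x: "x \<in> topspace X"
  obtain D where "P_closed D" "x \<in> D" by (rule P_closed_point[OF x])
  then show "e x \<in> topspace Y"
    using closure_subset_\<Lambda>[of D] e_in_closure_iff[of D x] x by (auto simp: topspace_Y P_closed_def)
qed

lemma continuous_e_Y: "continuous_map X Y e"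
  unfolding Y_def using continuous_e e_in_Y by (auto simp: continuous_map_in_subtopology topspace_Y)

lemma dense_Y: "Y closure_of (e ` topspace X) = topspace Y"
proof -
  have "e ` topspace X \<subseteq> \<Lambda>" using e_in_Y by (auto simp: topspace_Y)
  moreover have "\<Lambda> \<subseteq> topspace \<beta>" by (rule openin_subset[OF openin_\<Lambda>])
  ultimately show ?thesis
    by (simp add: topspace_Y) (simp add: Y_def closure_of_subtopology stone_cech_dense Int_absorb1 Int_absorb2)
qed

lemma Hausdorff_Y: "Hausdorff_space Y"
  unfolding Y_def by (intro Hausdorff_space_subtopology Hausdorff_space_stone_cech)

lemma locally_compact_Y: "locally_compact_space Y"
  unfolding Y_def
  by (intro locally_compact_space_open_subset openin_\<Lambda> disjI1 Hausdorff_space_stone_cech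
      compact_imp_locally_compact_space compact_space_stone_cech)

lemma nonempty_Y: "topspace Y \<noteq> {}"
  using nonempty e_in_Y by blast

lemma compactin_closure_Y:
  assumes "P_closed D"
  shows "compactin Y (\<beta> closure_of (e ` D))"
  unfolding Y_def compactin_subtopology
  by (intro conjI closure_subset_\<Lambda>[OF assms] closedin_compact_space[OF compact_space_stone_cech]
      closedin_closure_of)

section \<open>The sigma-ideal of covered sets\<close>

text \<open>If \<open>D S\<close> serves for \<open>S\<close>, then the closure of the union of all
  \<open>D S\<close> serves for the whole family.\<close>

lemma covered_Union:
  assumes "countable \<S>" "\<And>S. S \<in> \<S> \<Longrightarrow> covered S"
  shows "covered (\<Union>\<S>)"
proof -
  obtain D where D: "\<And>S. S \<in> \<S> \<Longrightarrow> P_closed (D S) \<and> S \<subseteq> \<beta> closure_of (e ` D S)"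
    using assms(2) unfolding covered_def by metis
  let ?D = "X closure_of \<Union> (D ` \<S>)"
  have "D S \<subseteq> topspace X" if "S \<in> \<S>" for S
    using D[OF that] closedin_subset[of X "D S"] by (simp add: P_closed_def)
  then have sub: "\<Union> (D ` \<S>) \<subseteq> topspace X" by (rule UN_least)
  have "P_closed ?D"
  proof (rule P_closed_closure_Union)
    show "countable (D ` \<S>)" using assms(1) by simp
    show "P_closed C" if "C \<in> D ` \<S>" for C
      using that D by (elim imageE) simp
  qed
  moreover have "\<Union>\<S> \<subseteq> \<beta> closure_of (e ` ?D)"
  proof (rule Union_least)
    fix S assume S: "S \<in> \<S>"
    have "D S \<subseteq> ?D" by (rule order_trans[OF UN_upper[OF S] closure_of_subset[OF sub]])
    then have "\<beta> closure_of (e ` D S) \<subseteq> \<beta> closure_of (e ` ?D)"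
      by (intro closure_of_mono image_mono)
    then show "S \<subseteq> \<beta> closure_of (e ` ?D)"
      by (rule order_trans[OF conjunct2[OF D[OF S]]])
  qed
  ultimately show ?thesis unfolding covered_def by (intro exI conjI)
qed

lemma covered_subset: "\<lbrakk>covered T; S \<subseteq> T\<rbrakk> \<Longrightarrow> covered S"
  unfolding covered_def by blast

lemma covered_point: "p \<in> topspace Y \<Longrightarrow> covered {p}"
  unfolding topspace_Y \<Lambda>_def covered_def by blast

text \<open>The interior of the closure of a cozero set is open in \<open>Y\<close> because
  \<Lambda> is open in \<beta>. The resulting open cover reduces covering properties of
  \<open>Y\<close> to the ideal of covered sets.\<close>

lemma covered_open_neighbourhood:
  assumes "p \<in> topspace Y"
  obtains U where "openin Y U" "p \<in> U" "covered U"
proof -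
  obtain D where D: "P_closed D" "p \<in> \<beta> closure_of (e ` D)"
    using assms unfolding topspace_Y \<Lambda>_def by blast
  obtain g :: "'a \<Rightarrow> real" where g: "P_closed (X closure_of {x \<in> topspace X. g x \<noteq> 0})"
    "\<beta> closure_of (e ` D) \<subseteq> \<beta> interior_of (\<beta> closure_of (e ` {x \<in> topspace X. g x \<noteq> 0}))"
    by (rule P_closed_imp_interior_neighbourhood[OF D(1)])
  let ?C = "{x \<in> topspace X. g x \<noteq> 0}"
  let ?I = "\<beta> interior_of (\<beta> closure_of (e ` ?C))"
  have "e ` ?C \<subseteq> e ` (X closure_of ?C)"
    by (intro image_mono closure_of_subset) auto
  then have sub: "?I \<subseteq> \<beta> closure_of (e ` (X closure_of ?C))"
    by (intro order_trans[OF interior_of_subset] closure_of_mono)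
  then have "?I \<subseteq> \<Lambda>" by (rule order_trans[OF _ closure_subset_\<Lambda>[OF g(1)]])
  then have "openin Y ?I"
    by (simp add: Y_def openin_open_subtopology[OF openin_\<Lambda>])
  moreover have "p \<in> ?I" using g(2) D(2) by (rule subsetD)
  moreover have "covered ?I"
    unfolding covered_def by (intro exI conjI) (rule g(1), rule sub)
  ultimately show ?thesis by (rule that)
qed

lemma Union_open_covered: "\<Union> {U. openin Y U \<and> covered U} = topspace Y"
proof
  show "topspace Y \<subseteq> \<Union> {U. openin Y U \<and> covered U}"
  proof
    fix p assume "p \<in> topspace Y"
    then obtain U where "openin Y U" "p \<in> U" "covered U" by (rule covered_open_neighbourhood)
    then show "p \<in> \<Union> {U. openin Y U \<and> covered U}" by blast
  qed
qed (auto dest: openin_subset)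

lemma covered_compactin:
  assumes "compactin Y K"
  shows "covered K"
proof -
  let ?\<U> = "{U. openin Y U \<and> covered U}"
  have "K \<subseteq> \<Union>?\<U>"
    unfolding Union_open_covered by (rule compactin_subset_topspace[OF assms])
  then obtain \<F> where F: "finite \<F>" "\<F> \<subseteq> ?\<U>" "K \<subseteq> \<Union>\<F>"
    using compactinD[OF assms, of ?\<U>] by blast
  have "covered (\<Union>\<F>)"
    using F by (intro covered_Union) (auto simp: countable_finite)
  then show ?thesis using F(3) by (rule covered_subset)
qed

text \<open>Points are covered, hence so are countable sets, and the closures in question are
  compact. Thus \<open>Y\<close> is omega-bounded, which is stronger than countably compact.\<close>

lemma countable_subset_imp_compact_superset:
  assumes "countable S" "S \<subseteq> topspace Y"
  obtains K where "compactin Y K" "S \<subseteq> K"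
proof -
  have "covered (\<Union> ((\<lambda>p. {p}) ` S))"
    using assms by (intro covered_Union) (auto intro: covered_point)
  then obtain D where "P_closed D" "S \<subseteq> \<beta> closure_of (e ` D)"
    unfolding covered_def by auto
  then show ?thesis by (intro that[OF compactin_closure_Y])
qed

lemma covered_topspace_imp_P:
  assumes "covered (topspace Y)"
  shows "P X"
proof -
  obtain D where D: "P_closed D" "topspace Y \<subseteq> \<beta> closure_of (e ` D)"
    using assms unfolding covered_def by blast
  have "x \<in> D" if "x \<in> topspace X" for x
    using e_in_closure_iff[of D x] D subsetD[OF D(2) e_in_Y[OF that]] that by (simp add: P_closed_def)
  then have "subtopology X D = X" by (intro subtopology_superset) blast
  then show ?thesis using D(1) by (simp add: P_closed_def)
qed

section \<open>Covering properties of \<open>Y\<close>\<close>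

lemma countably_compact_Y: "countably_compact_space Y"
  unfolding countably_compact_space_def
proof (intro allI impI, rule ccontr)
  fix \<U> assume \<U>: "countable \<U> \<and> (\<forall>U\<in>\<U>. openin Y U) \<and> \<Union>\<U> = topspace Y"
    and no: "\<nexists>\<V>. finite \<V> \<and> \<V> \<subseteq> \<U> \<and> \<Union>\<V> = topspace Y"
  \<comment> \<open>This enumeration is onto because a cover of the nonempty space \<open>Y\<close>
    is nonempty.\<close>
  define U where "U = from_nat_into \<U>"
  have "\<U> \<noteq> {}" using \<U> nonempty_Y by (metis Union_empty)
  then have U: "range U = \<U>" unfolding U_def using \<U> by (simp add: range_from_nat_into)
  \<comment> \<open>The first \<open>n + 1\<close> members never cover, which yields a sequence
    escaping every finite subfamily. A compact set containing that sequence gives the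
    contradiction.\<close>
  have "\<exists>y. y \<in> topspace Y \<and> (\<forall>i\<le>n. y \<notin> U i)" for n
  proof -
    have sub: "U ` {..n} \<subseteq> \<U>" using U by blast
    have "\<Union> (U ` {..n}) \<subseteq> \<Union>\<U>" by (rule Union_mono[OF sub])
    moreover have "\<Union> (U ` {..n}) \<noteq> topspace Y" using no sub by (metis finite_imageI finite_atMost)
    ultimately have "\<Union> (U ` {..n}) \<subset> topspace Y" using \<U> by simp
    then show ?thesis by blast
  qed
  then obtain y where y: "\<And>n. y n \<in> topspace Y" "\<And>i n. i \<le> n \<Longrightarrow> y n \<notin> U i" by metis
  have "range y \<subseteq> topspace Y" using y(1) by blast
  then obtain K where K: "compactin Y K" "range y \<subseteq> K"
    by (rule countable_subset_imp_compact_superset[OF countable_image[OF countableI_type]])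
  have "K \<subseteq> \<Union>\<U>" using compactin_subset_topspace[OF K(1)] \<U> by simp
  then obtain \<F> where \<F>: "finite \<F>" "\<F> \<subseteq> range U" "K \<subseteq> \<Union>\<F>"
    using compactinD[OF K(1), of \<U>] \<U> U by auto
  obtain N where N: "finite N" "\<F> = U ` N"
    using finite_subset_image[OF \<F>(1,2)] by auto
  obtain m where m: "\<And>i. i \<in> N \<Longrightarrow> i \<le> m"
    using N(1) unfolding finite_nat_set_iff_bounded_le by blast
  \<comment> \<open>The index \<open>m\<close> bounds those of the finite subcover, so
    \<open>y m\<close> avoids all its members.\<close>
  have "y m \<in> \<Union>\<F>" using K(2) \<F>(3) by blast
  then show False using N(2) m y(2) by blast
qed

lemma Lindelof_Y_imp_P:
  assumes "Lindelof_space Y"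
  shows "P X"
proof (rule covered_topspace_imp_P)
  let ?\<U> = "{U. openin Y U \<and> covered U}"
  obtain \<V> where "countable \<V>" "\<V> \<subseteq> ?\<U>" "\<Union>\<V> = topspace Y"
    using Lindelof_spaceD[OF assms, of ?\<U>] Union_open_covered by auto
  then show "covered (topspace Y)"
    using covered_Union[of \<V>] by auto
qed

text \<open>Points chosen from infinitely many nonempty members of a locally finite refinement would
  lie in one compact set, which meets only finitely many members. So the nonempty members form a
  finite cover by covered sets.\<close>

lemma paracompact_Y_imp_P:
  assumes "paracompact_space Y"
  shows "P X"
proof (rule covered_topspace_imp_P)
  let ?\<U> = "{U. openin Y U \<and> covered U}"
  have "(\<forall>U\<in>?\<U>. openin Y U) \<and> \<Union>?\<U> = topspace Y"
    using Union_open_covered by simp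
  from mp[OF spec[OF assms[unfolded paracompact_space_def]] this]
  obtain \<V> where \<V>: "\<forall>V\<in>\<V>. openin Y V \<and> (\<exists>U\<in>?\<U>. V \<subseteq> U)" "\<Union>\<V> = topspace Y"
    "locally_finite_in Y \<V>" by (elim exE conjE)
  have "finite (\<V> - {{}})"
  proof (rule ccontr)
    assume "infinite (\<V> - {{}})"
    then obtain f :: "nat \<Rightarrow> _" where f: "inj f" "range f \<subseteq> \<V> - {{}}"
      using infinite_countable_subset by blast
    have "\<exists>y. y \<in> f n" for n using rangeI[of f n] f(2) by blast
    then obtain y where y: "\<And>n. y n \<in> f n" by metis
    have "range y \<subseteq> topspace Y" using y f(2) \<V>(2) by blast
    then obtain K where K: "compactin Y K" "range y \<subseteq> K"
      by (rule countable_subset_imp_compact_superset[OF countable_image[OF countableI_type]])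
    have "range f \<subseteq> {V \<in> \<V>. V \<inter> K \<noteq> {}}" using y K(2) f(2) by blast
    then have "finite (range f)"
      using locally_finite_in_meets_compactin_finite[OF \<V>(3) K(1)] by (rule finite_subset)
    then show False using f(1) by (simp add: finite_image_iff)
  qed
  moreover have "covered V" if "V \<in> \<V> - {{}}" for V
  proof -
    obtain U where "covered U" "V \<subseteq> U" using \<V>(1) \<open>V \<in> \<V> - {{}}\<close> by auto
    then show ?thesis by (rule covered_subset)
  qed
  ultimately have "covered (\<Union> (\<V> - {{}}))"
    by (intro covered_Union countable_finite)
  moreover have "\<Union> (\<V> - {{}}) = topspace Y" using \<V>(2) by blast
  ultimately show "covered (topspace Y)" by simp
qed

end


subsection \<open>The algebra of functions whose support has \<open>P\<close>\<close>

context closed_sum_property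
begin

text \<open>The support is a closed part of any \<open>P\<close>-neighbourhood of it. Conversely,
  being its own closure, a support having \<open>P\<close> has such a neighbourhood by
  hypothesis.\<close>

lemma CP_iff: "f \<in> CP P X \<longleftrightarrow> f \<in> Cb X \<and> P_closed (supp X f)"
proof -
  have "(\<exists>N. P_neighbourhood P X (supp X f) N) \<longleftrightarrow> P_closed (supp X f)"
  proof
    assume "\<exists>N. P_neighbourhood P X (supp X f) N"
    then obtain N where N: "supp X f \<subseteq> X interior_of N" "P (subtopology X N)"
      unfolding P_neighbourhood_def by auto
    show "P_closed (supp X f)"
      by (rule P_closed_subset[OF N(2) closedin_supp order_trans[OF N(1) interior_of_subset]])
  next
    assume D: "P_closed (supp X f)"
    have "X closure_of supp X f = supp X f"
      by (rule closure_of_closedin[OF closedin_supp])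
    then show "\<exists>N. P_neighbourhood P X (supp X f) N"
      using closure_neighbourhood[OF closedin_subset[OF closedin_supp[of X f]]] D
      by (simp add: P_closed_def)
  qed
  then show ?thesis by (simp add: CP_def)
qed

lemma CP_eq: "CP P X = {f \<in> Cb X. P (subtopology X (supp X f))}"
  by (auto simp: CP_iff P_closed_def closedin_supp)

lemma CP_I:
  assumes "f \<in> Cb X" "P_closed D" "Coz X f \<subseteq> D"
  shows "f \<in> CP P X"
  unfolding CP_iff
proof (intro conjI assms(1) P_closed_subset[OF _ closedin_supp])
  show "P (subtopology X D)" using assms(2) by (simp add: P_closed_def)
  show "supp X f \<subseteq> D" using assms(2,3) by (simp add: P_closed_def supp_minimal)
qed

text \<open>The common criterion for the algebra operations, with a finite family, and for uniform
  limits, with the range of a sequence. The closure of the union of the supports has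
  \<open>P\<close>.\<close>

lemma CP_I_countable:
  assumes "f \<in> Cb X" "countable \<F>" "\<F> \<subseteq> CP P X" "Coz X f \<subseteq> \<Union> (Coz X ` \<F>)"
  shows "f \<in> CP P X"
proof (rule CP_I[OF assms(1)])
  show "P_closed (X closure_of \<Union> (supp X ` \<F>))"
  proof (rule P_closed_closure_Union)
    show "countable (supp X ` \<F>)" using assms(2) by simp
    show "P_closed C" if "C \<in> supp X ` \<F>" for C
      using that assms(3) by (auto simp: CP_iff)
  qed
  have "Coz X f \<subseteq> \<Union> (supp X ` \<F>)"
    using assms(4) Coz_subset_supp[of X] by blast
  also have "\<dots> \<subseteq> X closure_of \<Union> (supp X ` \<F>)"
    by (intro closure_of_subset UN_least closedin_subset closedin_supp)
  finally show "Coz X f \<subseteq> X closure_of \<Union> (supp X ` \<F>)" .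
qed

lemma CP_subset_Cb: "CP P X \<subseteq> Cb X"
  by (auto simp: CP_def)

lemma CP_zero: "(\<lambda>x\<in>topspace X. 0) \<in> CP P X"
  \<comment> \<open>The empty subspace has \<open>P\<close> as the closed sum of the empty
    family.\<close>
  by (rule CP_I_countable[of _ "{}"]) (auto simp: Cb_zero Coz_def)

lemma CP_add:
  assumes "f \<in> CP P X" "g \<in> CP P X"
  shows "(\<lambda>x\<in>topspace X. f x + g x) \<in> CP P X"
proof (rule CP_I_countable[of _ "{f, g}"])
  show "(\<lambda>x\<in>topspace X. f x + g x) \<in> Cb X"
    using assms by (simp add: CP_def Cb_add)
qed (use assms Coz_add[of X f g] in simp_all)

lemma CP_scale:
  assumes "f \<in> CP P X"
  shows "(\<lambda>x\<in>topspace X. c * f x) \<in> CP P X"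
proof (rule CP_I_countable[of _ "{f}"])
  show "(\<lambda>x\<in>topspace X. c * f x) \<in> Cb X"
    using assms by (simp add: CP_def Cb_scale)
qed (use assms in \<open>auto simp: Coz_def\<close>)

lemma CP_mult:
  assumes "f \<in> CP P X" "g \<in> CP P X"
  shows "(\<lambda>x\<in>topspace X. f x * g x) \<in> CP P X"
proof (rule CP_I_countable[of _ "{f}"])
  show "(\<lambda>x\<in>topspace X. f x * g x) \<in> Cb X"
    using assms by (simp add: CP_def Cb_mult)
qed (use assms in \<open>auto simp: Coz_def\<close>)

text \<open>The space of all bounded continuous functions is complete, so sequential closedness
  suffices.\<close>

lemma mcomplete_CP:
  "mcomplete_of (submetric (cfunspace X euclidean_metric)
     (CP P X :: ('a \<Rightarrow> 'k::{real_normed_field, complete_space}) set))"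
proof -
  let ?m = "cfunspace X (euclidean_metric :: 'k metric)"
  let ?A = "CP P X :: ('a \<Rightarrow> 'k) set"
  have A: "?A \<subseteq> mspace ?m" using CP_subset_Cb unfolding Cb_def .
  interpret M: Metric_space "mspace ?m" "mdist ?m" by (rule Metric_space_mspace_mdist)
  interpret S: Submetric "mspace ?m" "mdist ?m" ?A by unfold_locales (rule A)
  have "mcomplete_of ?m"
    using Met_TC.mcomplete_cfunspace[where ?'a='k] complete_UNIV
    by (simp add: euclidean_metric_def Met_TC.Self_def)
  then have "M.mcomplete" by (simp add: mcomplete_of_def)
  then have "S.sub.mcomplete"
  proof (rule S.sequentially_closedin_mcomplete_imp_mcomplete)
    fix \<sigma> l assume \<sigma>: "range \<sigma> \<subseteq> ?A \<and> limitin M.mtopology \<sigma> l sequentially"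
    then have l: "l \<in> mspace ?m" unfolding M.limitin_metric by blast
    \<comment> \<open>A term closer to \<open>l\<close> than \<open>norm (l x)\<close> cannot vanish
      at \<open>x\<close>, so the cozero set of the limit lies in the union of those of the
      terms.\<close>
    have "x \<in> \<Union> (Coz X ` range \<sigma>)" if x: "x \<in> Coz X l" for x
    proof -
      have x': "x \<in> topspace X" "norm (l x) > 0" using x by (auto simp: Coz_def)
      obtain n where n: "\<sigma> n \<in> mspace ?m" "mdist ?m (\<sigma> n) l < norm (l x)"
        using \<sigma> x'(2) unfolding M.limit_metric_sequentially by blast
      have "dist (\<sigma> n x) (l x) \<le> mdist ?m (\<sigma> n) l"
        using cfunspace_mdist_le[OF n(1) l nonempty] x'(1) by force
      with n(2) have "\<sigma> n x \<noteq> 0" by (auto simp: dist_norm)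
      then show ?thesis using x'(1) by (auto simp: Coz_def)
    qed
    then show "l \<in> ?A"
      using l \<sigma> by (intro CP_I_countable[of _ "range \<sigma>"]) (auto simp: Cb_def simp del: mspace_cfunspace)
  qed
  then show ?thesis using A by (simp add: mcomplete_of_def Int_absorb2 del: mspace_cfunspace)
qed

lemma banach_subalgebra_CP:
  "banach_subalgebra X (CP P X :: ('a \<Rightarrow> 'k::{real_normed_field, complete_space}) set)"
  unfolding banach_subalgebra_def
  by (intro conjI ballI allI CP_subset_Cb CP_zero CP_add CP_scale CP_mult mcomplete_CP)

section \<open>Compactly supported functions on \<open>Y\<close>\<close>

lemma Cc_Y_I:
  assumes "h \<in> Cb Y" "covered (Coz Y h)"
  shows "h \<in> Cc Y"
proof -
  obtain D where D: "P_closed D" "Coz Y h \<subseteq> \<beta> closure_of (e ` D)"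
    using assms(2) unfolding covered_def by blast
  have K: "compactin Y (\<beta> closure_of (e ` D))" by (rule compactin_closure_Y[OF D(1)])
  show ?thesis
    by (rule Cc_I[OF assms(1) K compactin_imp_closedin[OF Hausdorff_Y K] D(2)])
qed

text \<open>The cozero set of a function in \<open>C0 Y\<close> is a countable union of compact,
  hence covered, sets.\<close>

lemma Cc_Y_eq_C0_Y: "(Cc Y :: (_ \<Rightarrow> 'k::real_normed_field) set) = C0 Y"
proof
  show "(C0 Y :: (_ \<Rightarrow> 'k) set) \<subseteq> Cc Y"
  proof
    fix h :: "_ \<Rightarrow> 'k" assume h: "h \<in> C0 Y"
    \<comment> \<open>The successor matters: \<open>inverse 0 = 0\<close> would make the first set
      all of \<open>Y\<close>.\<close>
    define K where "K n = {y \<in> topspace Y. inverse (real (Suc n)) \<le> norm (h y)}" for n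
    have "covered (\<Union> (range K))"
    proof (rule covered_Union)
      show "covered S" if "S \<in> range K" for S
        using that h by (auto simp: K_def C0_def intro!: covered_compactin)
    qed simp
    moreover have "Coz Y h \<subseteq> \<Union> (range K)"
    proof
      fix y assume "y \<in> Coz Y h"
      then have y: "y \<in> topspace Y" "0 < norm (h y)" by (auto simp: Coz_def)
      obtain n where "inverse (real (Suc n)) < norm (h y)" using reals_Archimedean[OF y(2)] by blast
      then show "y \<in> \<Union> (range K)" using y(1) by (auto simp: K_def intro!: exI[of _ n])
    qed
    ultimately have "covered (Coz Y h)" by (rule covered_subset)
    then show "h \<in> Cc Y" using h by (intro Cc_Y_I) (auto simp: C0_def)
  qed
qed (rule Cc_subset_C0)

section \<open>Restriction to \<open>X\<close> as an isometric isomorphism\<close>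

definition pullback :: "((('a \<Rightarrow> real) \<Rightarrow> real) \<Rightarrow> 'k::real_normed_field) \<Rightarrow> 'a \<Rightarrow> 'k" where
  "pullback h = (\<lambda>x\<in>topspace X. h (e x))"

lemma pullback_in_Cb:
  assumes "h \<in> Cb Y"
  shows "pullback h \<in> Cb X"
proof -
  obtain B where B: "\<And>y. y \<in> topspace Y \<Longrightarrow> norm (h y) \<le> B" using Cb_bound[OF assms] by metis
  have "continuous_map X euclidean (h \<circ> e)"
    using assms by (intro continuous_map_compose[OF continuous_e_Y]) (simp add: mem_Cb)
  then show ?thesis
    unfolding pullback_def by (intro Cb_restrictI[where B=B]) (simp_all add: o_def B e_in_Y)
qed

lemma pullback_in_CP:
  assumes "h \<in> Cc Y"
  shows "pullback h \<in> CP P X"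
proof -
  have h: "h \<in> Cb Y" "compactin Y (supp Y h)" using assms by (auto simp: Cc_def)
  obtain D where D: "P_closed D" "supp Y h \<subseteq> \<beta> closure_of (e ` D)"
    using covered_compactin[OF h(2)] unfolding covered_def by blast
  show ?thesis
  proof (rule CP_I[OF pullback_in_Cb[OF h(1)] D(1)])
    show "Coz X (pullback h) \<subseteq> D"
    proof
      fix x assume "x \<in> Coz X (pullback h)"
      then have x: "x \<in> topspace X" "h (e x) \<noteq> 0" by (auto simp: Coz_def pullback_def)
      then have "e x \<in> Coz Y h" using e_in_Y by (simp add: Coz_def)
      then have "e x \<in> \<beta> closure_of (e ` D)" using Coz_subset_supp[of Y h] D(2) by blast
      then show "x \<in> D" using e_in_closure_iff[of D x] D(1) x(1) by (simp add: P_closed_def)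
    qed
  qed
qed

text \<open>The preimage is the Stone--Cech extension of \<open>f\<close>, restricted to
  \<open>Y\<close>. Its cozero set lies in the closure of the support of \<open>f\<close>, hence is
  covered.\<close>

lemma pullback_surj:
  fixes f :: "'a \<Rightarrow> 'k::{real_normed_field, heine_borel}"
  assumes "f \<in> CP P X"
  obtains h where "h \<in> Cc Y" "pullback h = f"
proof -
  have f: "f \<in> Cb X" "P_closed (supp X f)" using assms by (auto simp: CP_iff)
  obtain F where F: "continuous_map \<beta> euclidean F" "\<And>x. x \<in> topspace X \<Longrightarrow> F (e x) = f x"
    using f(1) unfolding mem_Cb by (metis stone_cech_extension_heine_borel)
  define h where "h = restrict F (topspace Y)"
  have "compact (F ` topspace \<beta>)"
    using image_compactin[OF compact_space_stone_cech[unfolded compact_space_def] F(1)] by simp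
  then obtain B where B: "\<And>y. y \<in> topspace \<beta> \<Longrightarrow> norm (F y) \<le> B"
    using compact_imp_bounded[of "F ` topspace \<beta>"] unfolding bounded_iff by auto
  have sub: "topspace Y \<subseteq> topspace \<beta>" unfolding topspace_Y by (rule openin_subset[OF openin_\<Lambda>])
  have "continuous_map Y euclidean F"
    unfolding Y_def by (rule continuous_map_from_subtopology[OF F(1)])
  then have h: "h \<in> Cb Y"
    unfolding h_def using B sub by (intro Cb_restrictI[where B=B]) auto
  define U where "U = {p \<in> topspace \<beta>. F p \<in> - {0}}"
  have U: "openin \<beta> U"
    unfolding U_def by (rule openin_continuous_map_preimage[OF F(1)]) (simp add: open_Compl)
  have "Coz Y h \<subseteq> U" using sub by (auto simp: Coz_def h_def U_def)
  also have "U \<subseteq> \<beta> closure_of (e ` {x \<in> topspace X. e x \<in> U})"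
    by (rule openin_subset_closure_of_trace[OF U])
  also have "\<dots> \<subseteq> \<beta> closure_of (e ` supp X f)"
  proof (intro closure_of_mono image_mono)
    show "{x \<in> topspace X. e x \<in> U} \<subseteq> supp X f"
      using Coz_subset_supp[of X f] F(2) by (auto simp: U_def Coz_def)
  qed
  finally have "covered (Coz Y h)" unfolding covered_def using f(2) by blast
  then have "h \<in> Cc Y" by (rule Cc_Y_I[OF h])
  moreover have "pullback h = f"
    using f(1) F(2) e_in_Y by (intro extensionalityI[of _ "topspace X"]) (auto simp: pullback_def h_def mem_Cb)
  ultimately show ?thesis by (rule that)
qed

lemma pullback_inject:
  assumes "h \<in> Cb Y" "h' \<in> Cb Y" "pullback h = pullback h'"
  shows "h = h'"
proof (rule extensionalityI[of _ "topspace Y"])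
  show "h \<in> extensional (topspace Y)" "h' \<in> extensional (topspace Y)"
    using assms by (simp_all add: mem_Cb)
  have eq: "h p = h' p" if p: "p \<in> e ` topspace X" for p
  proof -
    obtain x where x: "x \<in> topspace X" "p = e x" using p by blast
    then show ?thesis using fun_cong[OF assms(3), of x] by (simp add: pullback_def)
  qed
  have c: "continuous_map Y euclidean h" "continuous_map Y euclidean h'"
    using assms(1,2) by (simp_all add: mem_Cb)
  show "h y = h' y" if "y \<in> topspace Y" for y
    by (rule continuous_map_eq_on_dense[OF dense_Y c eq that])
qed

text \<open>An upper bound for the norm is a closed condition, so it passes from the dense image of
  \<open>X\<close> to \<open>Y\<close>; both norms thus have the same upper bounds.\<close>

lemma sup_norm_pullback:
  assumes h: "h \<in> Cb Y"
  shows "sup_norm X (pullback h) = sup_norm Y h"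
proof -
  have "(\<forall>x\<in>topspace X. norm (h (e x)) \<le> a) \<longleftrightarrow> (\<forall>y\<in>topspace Y. norm (h y) \<le> a)" for a
  proof
    assume L: "\<forall>x\<in>topspace X. norm (h (e x)) \<le> a"
    have "continuous_map Y euclidean (\<lambda>y. norm (h y))"
      using h by (simp add: mem_Cb continuous_map_norm)
    from closedin_continuous_map_preimage[OF this, of "{..a}"]
    have cl: "closedin Y {y \<in> topspace Y. norm (h y) \<le> a}" by simp
    show "\<forall>y\<in>topspace Y. norm (h y) \<le> a"
    proof
      fix y assume "y \<in> topspace Y"
      then have "y \<in> Y closure_of (e ` topspace X)" by (simp add: dense_Y)
      then show "norm (h y) \<le> a" by (rule forall_in_closure_of[OF _ _ cl]) (use L in auto)
    qed
  qed (use e_in_Y in blast)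
  then have "sup_norm X (pullback h) \<le> a \<longleftrightarrow> sup_norm Y h \<le> a" for a
    using sup_norm_le_iff[OF pullback_in_Cb[OF h] nonempty] sup_norm_le_iff[OF h nonempty_Y]
    by (simp add: pullback_def)
  then show ?thesis by (meson order_antisym order_refl)
qed

lemma pullback_isometric_isomorphism:
  "isometric_isomorphism Y (Cc Y) X (CP P X)
     (pullback :: (_ \<Rightarrow> 'k::{real_normed_field, heine_borel}) \<Rightarrow> _)"
  unfolding isometric_isomorphism_def
proof (intro conjI ballI allI)
  show "bij_betw (pullback :: (_ \<Rightarrow> 'k) \<Rightarrow> _) (Cc Y) (CP P X)"
  proof (rule bij_betw_imageI)
    show "inj_on (pullback :: (_ \<Rightarrow> 'k) \<Rightarrow> _) (Cc Y)"
      by (rule inj_onI) (auto intro: pullback_inject simp: Cc_def)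
    show "(pullback :: (_ \<Rightarrow> 'k) \<Rightarrow> _) ` Cc Y = CP P X"
    proof
      show "pullback ` Cc Y \<subseteq> (CP P X :: ('a \<Rightarrow> 'k) set)"
        by (intro image_subsetI pullback_in_CP)
      show "CP P X \<subseteq> (pullback :: (_ \<Rightarrow> 'k) \<Rightarrow> _) ` Cc Y"
      proof
        fix f :: "'a \<Rightarrow> 'k" assume "f \<in> CP P X"
        then obtain h where "h \<in> Cc Y" "pullback h = f" by (rule pullback_surj)
        then show "f \<in> pullback ` Cc Y" by (intro image_eqI[of _ _ h]) simp_all
      qed
    qed
  qed
next
  fix f :: "_ \<Rightarrow> 'k" assume "f \<in> Cc Y"
  then show "sup_norm X (pullback f) = sup_norm Y f"
    by (intro sup_norm_pullback) (simp add: Cc_def)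
qed (auto simp: pullback_def e_in_Y intro!: restrict_ext)

lemma isometrically_isomorphic_CP_Cc_Y:
  "isometrically_isomorphic X (CP P X :: ('a \<Rightarrow> 'k::{real_normed_field, heine_borel}) set) Y (Cc Y)"
  unfolding isometrically_isomorphic_def
proof (rule exI, rule isometric_isomorphism_inverse[OF pullback_isometric_isomorphism])
  show "(\<lambda>y\<in>topspace Y. f y + g y) \<in> Cc Y" if "f \<in> Cc Y" "g \<in> Cc Y" for f g :: "_ \<Rightarrow> 'k"
    using that by (rule Cc_add)
  show "(\<lambda>y\<in>topspace Y. c * f y) \<in> Cc Y" if "f \<in> Cc Y" for c and f :: "_ \<Rightarrow> 'k"
    using that by (rule Cc_scale)
  show "(\<lambda>y\<in>topspace Y. f y * g y) \<in> Cc Y" if "f \<in> Cc Y" "g \<in> Cc Y" for f g :: "_ \<Rightarrow> 'k"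
    using that by (intro Cc_mult) (simp_all add: Cc_def)
qed

text \<open>Through \<open>CP P X\<close>, the algebras \<open>Cc Z\<close> and \<open>Cc Y\<close>
  are isomorphic, and such an algebra determines its locally compact Hausdorff space.\<close>

lemma Y_unique:
  fixes Z :: "'z topology"
  assumes Z: "locally_compact_space Z" "Hausdorff_space Z"
    and iso: "isometrically_isomorphic X (CP P X :: ('a \<Rightarrow> 'k::{real_normed_field, heine_borel}) set) Z (Cc Z)"
  shows "Z homeomorphic_space Y"
proof -
  obtain T where T: "isometric_isomorphism X (CP P X :: ('a \<Rightarrow> 'k) set) Z (Cc Z) T"
    using iso unfolding isometrically_isomorphic_def by blast
  obtain S where S: "isometric_isomorphism X (CP P X :: ('a \<Rightarrow> 'k) set) Y (Cc Y) S"
    using isometrically_isomorphic_CP_Cc_Y unfolding isometrically_isomorphic_def by blast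
  have "isometric_isomorphism Z (Cc Z) X (CP P X) (inv_into (CP P X) T)"
    by (rule isometric_isomorphism_inverse[OF T CP_add CP_scale CP_mult])
  from isometric_isomorphism_compose[OF this S] show ?thesis
    by (rule isometric_isomorphism_Cc_imp_homeomorphic_space[OF Z locally_compact_Y Hausdorff_Y])
qed

end

theorem theorem3p1:
  fixes P :: "'a topology \<Rightarrow> bool" and X :: "'a topology"
  assumes "topological_property P"
    and "closed_hereditary P"
    and "preserved_under_countable_closed_sums P"
    and "topspace X \<noteq> {}" and "normal_space X" and "Hausdorff_space X"
    and "locally_P_space P X"
    and "\<And>S. S \<subseteq> topspace X \<Longrightarrow> P (subtopology X S) \<Longrightarrow>
           \<exists>N. P_neighbourhood P X (X closure_of S) N"
  shows "let A = (CP P X :: ('a \<Rightarrow> 'k::{real_normed_field, heine_borel}) set);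
             Y = lambda_P TYPE('k) P X
         in banach_subalgebra X A \<and>
            topspace Y \<noteq> {} \<and> locally_compact_space Y \<and> Hausdorff_space Y \<and>
            isometrically_isomorphic X A Y (Cc Y) \<and>
            (\<forall>Z :: 'z topology.
               topspace Z \<noteq> {} \<and> locally_compact_space Z \<and> Hausdorff_space Z \<and>
               isometrically_isomorphic X A Z (Cc Z) \<longrightarrow> Z homeomorphic_space Y) \<and>
            A = {f \<in> Cb X. P (subtopology X (supp X f))} \<and>
            (Cc Y :: ((('a \<Rightarrow> real) \<Rightarrow> real) \<Rightarrow> 'k) set) = C0 Y \<and>
            countably_compact_space Y \<and>
            (\<not> P X \<longrightarrow> \<not> Lindelof_space Y \<and> \<not> paracompact_space Y)"
proof -
  interpret closed_sum_property P X
    using assms(2-) by unfold_locales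
  have lambda: "lambda_P TYPE('k) P X = Y" by (simp add: lambda_P_eq Y_def)
  show ?thesis
    unfolding Let_def lambda
  proof (intro conjI allI impI)
    show "\<not> Lindelof_space Y" "\<not> paracompact_space Y" if "\<not> P X"
      using that Lindelof_Y_imp_P paracompact_Y_imp_P by metis+
    show "Z homeomorphic_space Y" if "topspace Z \<noteq> {} \<and> locally_compact_space Z \<and> Hausdorff_space Z \<and>
        isometrically_isomorphic X (CP P X :: ('a \<Rightarrow> 'k) set) Z (Cc Z)" for Z :: "'z topology"
      using that by (elim conjE) (rule Y_unique)
  qed (rule banach_subalgebra_CP nonempty_Y locally_compact_Y Hausdorff_Y
      isometrically_isomorphic_CP_Cc_Y CP_eq Cc_Y_eq_C0_Y countably_compact_Y)+
qed

end
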